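(* Let $\theta$ be an inner function, let $\theta_0$ be its $0$-th Fourier coefficient, and let $\phi\in L^\infty$. Then the dual truncated Hankel operator $\mathcal{H}_\phi^\theta$ satisfies $$\mathcal{H}_\phi^\theta U_\theta-U_\theta^*\mathcal{H}_\phi^\theta=\bar z\otimes Q_\theta J(\alpha_{\phi^*})-Q_\theta J(\alpha_\phi)\otimes\bar z,$$ where $\alpha_\phi=\phi(1-\bar\theta_0\theta)$ and $\alpha_{\phi^*}=\phi^*(1-\bar\theta_0\theta)$.
   Context: $\mathbb{T}$ is the unit circle with normalized Lebesgue measure, $L^2=L^2(\mathbb{T})$ with inner product $\langle\cdot,\cdot\rangle$ linear in the first entry, $L^\infty=L^\infty(\mathbb{T})$. $H^2\subset L^2$ is the Hardy space (functions whose negative Fourier coefficients vanish), $H_0^2=zH^2$, $\overline{H_0^2}=L^2\ominus H^2$. $P:L^2\to H^2$ is the orthogonal projection and $Q=I-P$ is the orthogonal projection onto $\overline{H_0^2}$. The flip $J$ on $L^2$ is $(Jf)(z)=f(\bar z)$, $z\in\mathbb{T}$. For an inner function $\theta$ (bounded analytic on the disk, unimodular a.e. on $\mathbb{T}$), $K_\theta=H^2\ominus\theta H^2$ and $K_\theta^\perp=L^2\ominus K_\theta=\overline{H_0^2}\oplus\theta H^2$; $Q_\theta=Q+\theta P\bar\theta$ is the orthogonal projection of $L^2$ onto $K_\theta^\perp$. For $\phi\in L^\infty$ the dual truncated Hankel operator is $\mathcal{H}_\phi^\theta:K_\theta^\perp\to K_\theta^\perp$, $\mathcal{H}_\phi^\theta(h)=Q_\theta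 J(\phi h)$. The compressed shift on $K_\theta^\perp$ is $U_\theta h=Q_\theta(zh)$. For $f,g$ in a Hilbert space, $f\otimes g$ is the operator $h\mapsto\langle h,g\rangle f$. For $\phi\in L^2$, $\phi^*(z)=\overline{\phi(\bar z)}$ on $\mathbb{T}$. *)

theory Defs
  imports "HOL-Analysis.Analysis"
begin

section \<open>The unit circle and its function spaces\<close>

text \<open>Normalized Lebesgue measure on the unit circle. Its space is the circle itself, so
  measurability and integrals of a function \<open>complex \<Rightarrow> complex\<close> depend only on its values there.\<close>

definition circle :: "complex measure" where
  "circle = distr (uniform_measure lborel {-pi..pi}) (restrict_space borel (sphere 0 1)) cis"

definition square_integrable :: "(complex \<Rightarrow> complex) \<Rightarrow> bool" where
  "square_integrable f \<longleftrightarrow>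
     f \<in> borel_measurable circle \<and> integrable circle (\<lambda>z. (cmod (f z))\<^sup>2)"

definition L_infinity :: "(complex \<Rightarrow> complex) set" where
  "L_infinity = {f. f \<in> borel_measurable circle \<and> (\<exists>C. AE z in circle. cmod (f z) \<le> C)}"

lemma measurable_cis_circle [measurable]:
  "cis \<in> measurable (uniform_measure lborel {-pi..pi}) (restrict_space borel (sphere 0 1))"
proof (rule measurable_restrict_space2)
  have "cis \<in> borel_measurable borel"
    by (intro borel_measurable_continuous_onI continuous_intros)
  then show "cis \<in> borel_measurable (uniform_measure lborel {-pi..pi})"
    by simp
qed (auto simp: norm_cis)

lemma sets_circle [simp, measurable_cong]: "sets circle = sets (restrict_space borel (sphere 0 1))"
  by (simp add: circle_def)

lemma space_circle [simp]: "space circle = sphere 0 1"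
  by (simp add: circle_def space_restrict_space)

lemma measurable_cnj_circle [measurable]: "cnj \<in> measurable circle circle"
proof -
  have "cnj \<in> measurable (restrict_space borel (sphere 0 1)) (restrict_space borel (sphere 0 1))"
  proof (rule measurable_restrict_space3)
    show "cnj \<in> borel_measurable borel"
      by (intro borel_measurable_continuous_onI continuous_intros)
  qed auto
  then show ?thesis
    by (simp cong: measurable_cong_sets)
qed

lemma borel_measurable_cnj_comp:
  "f \<in> borel_measurable M \<Longrightarrow> (\<lambda>z. cnj (f z)) \<in> borel_measurable M"
  by (rule borel_measurable_continuous_on) (intro continuous_intros)

lemma borel_measurable_powi_circle: "(\<lambda>z. z powi n) \<in> borel_measurable circle"
proof -
  have "continuous_on (sphere 0 1) (\<lambda>z::complex. z powi n)"
    by (intro continuous_intros) auto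
  then show ?thesis
    using borel_measurable_continuous_on_restrict by (simp cong: measurable_cong_sets)
qed

lemma distr_uniform_uminus:
  "distr (uniform_measure lborel {-pi..pi}) (uniform_measure lborel {-pi..pi}) uminus =
    uniform_measure lborel {-pi..pi::real}"
proof (rule measure_eqI)
  fix A assume "A \<in> sets (distr (uniform_measure lborel {-pi..pi}) (uniform_measure lborel {-pi..pi}) uminus)"
  then have A [measurable]: "A \<in> sets (borel :: real measure)" by simp
  have vA: "uminus -` A \<in> sets (borel :: real measure)"
    using measurable_sets[OF borel_measurable_uminus[OF measurable_ident], of A] A by simp
  have "emeasure lborel ({-pi..pi} \<inter> A) =
      emeasure (distr lborel borel uminus) ({-pi..pi} \<inter> A)"
    by (simp add: lborel_distr_uminus)
  also have "\<dots> = emeasure lborel (uminus -` ({-pi..pi} \<inter> A))"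
    by (subst emeasure_distr) auto
  also have "uminus -` ({-pi..pi} \<inter> A) = {-pi..pi} \<inter> uminus -` A" by auto
  finally have eq: "emeasure lborel ({-pi..pi} \<inter> uminus -` A) = emeasure lborel ({-pi..pi} \<inter> A)"
    by simp
  show "emeasure (distr (uniform_measure lborel {-pi..pi}) (uniform_measure lborel {-pi..pi}) uminus) A =
      emeasure (uniform_measure lborel {-pi..pi}) A"
    using A vA eq by (subst emeasure_distr) (auto simp: emeasure_uniform_measure)
qed simp

lemma distr_circle_cnj: "distr circle circle cnj = circle"
proof -
  let ?U = "uniform_measure lborel {-pi..pi}" and ?S = "restrict_space borel (sphere 0 1)"
  have "distr circle circle cnj = distr (distr ?U ?S cis) circle cnj"
    by (simp add: circle_def)
  also have "\<dots> = distr ?U circle (cnj \<circ> cis)"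
    using measurable_cnj_circle by (intro distr_distr) (auto cong: measurable_cong_sets)
  also have "cnj \<circ> cis = cis \<circ> uminus"
    by (auto simp: cis_cnj)
  also have "distr ?U circle (cis \<circ> uminus) = distr (distr ?U ?U uminus) circle cis"
    using measurable_cis_circle
    by (intro distr_distr[symmetric]) (auto cong: measurable_cong_sets)
  also have "\<dots> = distr ?U circle cis"
    by (simp only: distr_uniform_uminus)
  also have "\<dots> = circle"
    unfolding circle_def by (intro distr_cong) auto
  finally show ?thesis .
qed

lemma AE_circle_cnj: "(AE z in circle. R (cnj z)) \<longleftrightarrow> (AE z in circle. R z)"
proof -
  have *: "AE z in circle. R (cnj z)" if "AE z in circle. R z" for R
    by (rule AE_distrD[OF measurable_cnj_circle]) (use that in \<open>simp only: distr_circle_cnj\<close>)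
  show ?thesis
    using *[of R] *[of "\<lambda>z. R (cnj z)"] by (simp only: complex_cnj_cnj) blast
qed

lemma square_integrable_zero: "square_integrable (\<lambda>z. 0)"
  by (simp add: square_integrable_def)

lemma square_integrable_mult:
  assumes "g \<in> L_infinity" "square_integrable f"
  shows "square_integrable (\<lambda>z. g z * f z)"
proof -
  from assms have [measurable]: "g \<in> borel_measurable circle" "f \<in> borel_measurable circle"
    and int: "integrable circle (\<lambda>z. (cmod (f z))\<^sup>2)"
    by (auto simp: L_infinity_def square_integrable_def)
  from assms obtain C where C: "AE z in circle. cmod (g z) \<le> C"
    by (auto simp: L_infinity_def)
  have "integrable circle (\<lambda>z. (cmod (g z * f z))\<^sup>2)"
  proof (rule Bochner_Integration.integrable_bound)
    show "integrable circle (\<lambda>z. C\<^sup>2 * (cmod (f z))\<^sup>2)"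
      using int by simp
    show "AE z in circle. norm ((cmod (g z * f z))\<^sup>2) \<le> norm (C\<^sup>2 * (cmod (f z))\<^sup>2)"
      using C by eventually_elim
        (auto simp: norm_mult power_mult_distrib intro!: mult_right_mono power_mono)
  qed measurable
  then show ?thesis by (simp add: square_integrable_def)
qed

lemma square_integrable_add:
  assumes "square_integrable f" "square_integrable g"
  shows "square_integrable (\<lambda>z. f z + g z)"
proof -
  from assms have [measurable]: "g \<in> borel_measurable circle" "f \<in> borel_measurable circle"
    and int: "integrable circle (\<lambda>z. (cmod (f z))\<^sup>2)" "integrable circle (\<lambda>z. (cmod (g z))\<^sup>2)"
    by (auto simp: square_integrable_def)
  have bound: "(cmod (a + b))\<^sup>2 \<le> 2 * (cmod a)\<^sup>2 + 2 * (cmod b)\<^sup>2" for a b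
  proof -
    have "(cmod (a + b))\<^sup>2 \<le> (cmod a + cmod b)\<^sup>2"
      by (intro power_mono norm_triangle_ineq) auto
    also have "\<dots> \<le> 2 * (cmod a)\<^sup>2 + 2 * (cmod b)\<^sup>2"
      using zero_le_power2[of "cmod a - cmod b"] by (simp add: power2_eq_square algebra_simps)
    finally show ?thesis .
  qed
  have "integrable circle (\<lambda>z. (cmod (f z + g z))\<^sup>2)"
  proof (rule Bochner_Integration.integrable_bound)
    show "integrable circle (\<lambda>z. 2 * (cmod (f z))\<^sup>2 + 2 * (cmod (g z))\<^sup>2)"
      using int by simp
    show "AE z in circle. norm ((cmod (f z + g z))\<^sup>2)
        \<le> norm (2 * (cmod (f z))\<^sup>2 + 2 * (cmod (g z))\<^sup>2)"
      using bound by (intro AE_I2) simp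
  qed measurable
  then show ?thesis by (simp add: square_integrable_def)
qed

lemma square_integrable_cmult:
  "square_integrable f \<Longrightarrow> square_integrable (\<lambda>z. c * f z)"
  by (rule square_integrable_mult) (auto simp: L_infinity_def)

lemma square_integrable_diff:
  assumes "square_integrable f" "square_integrable g"
  shows "square_integrable (\<lambda>z. f z - g z)"
  using square_integrable_add[OF assms(1) square_integrable_cmult[OF assms(2), of "-1"]] by simp

lemma square_integrable_flip:
  assumes "square_integrable f"
  shows "square_integrable (\<lambda>z. f (cnj z))"
proof -
  from assms have [measurable]: "f \<in> borel_measurable circle"
    and int: "integrable circle (\<lambda>z. (cmod (f z))\<^sup>2)"
    by (auto simp: square_integrable_def)
  have "integrable circle (\<lambda>z. (cmod (f (cnj z)))\<^sup>2)"
    using integrable_distr[OF measurable_cnj_circle, of "\<lambda>z. (cmod (f z))\<^sup>2"] int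
    by (simp add: distr_circle_cnj)
  moreover have "(\<lambda>z. f (cnj z)) \<in> borel_measurable circle"
    by measurable
  ultimately show ?thesis by (simp add: square_integrable_def)
qed


section \<open>The Hilbert space of square integrable functions modulo null sets\<close>

definition L2_eq :: "(complex \<Rightarrow> complex) \<Rightarrow> (complex \<Rightarrow> complex) \<Rightarrow> bool" where
  "L2_eq f g \<longleftrightarrow> square_integrable f \<and> square_integrable g \<and> (AE z in circle. f z = g z)"

quotient_type L2 = "complex \<Rightarrow> complex" / partial: L2_eq
proof (rule part_equivpI)
  show "\<exists>f. L2_eq f f"
    using square_integrable_zero by (auto simp: L2_eq_def)
  show "symp L2_eq"
    by (rule sympI) (auto simp: L2_eq_def elim: eventually_mono)
  show "transp L2_eq"
  proof (rule transpI)
    fix f g h assume *: "L2_eq f g" "L2_eq g h"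
    then have "AE z in circle. f z = g z" "AE z in circle. g z = h z"
      by (auto simp: L2_eq_def)
    then have "AE z in circle. f z = h z" by eventually_elim simp
    with * show "L2_eq f h" by (auto simp: L2_eq_def)
  qed
qed

text \<open>The element of \<open>L2\<close> represented by \<open>f\<close>; meaningful only for square integrable \<open>f\<close>.\<close>

abbreviation L2_class :: "(complex \<Rightarrow> complex) \<Rightarrow> L2" where
  "L2_class \<equiv> abs_L2"

instantiation L2 :: ab_group_add
begin

lift_definition zero_L2 :: L2 is "\<lambda>z. 0"
  using square_integrable_zero by (auto simp: L2_eq_def)

lift_definition plus_L2 :: "L2 \<Rightarrow> L2 \<Rightarrow> L2" is "\<lambda>f g z. f z + g z"
  by (auto simp: L2_eq_def intro: square_integrable_add)

lift_definition uminus_L2 :: "L2 \<Rightarrow> L2" is "\<lambda>f z. - f z"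
  using square_integrable_cmult[where c = "-1"] by (auto simp: L2_eq_def)

lift_definition minus_L2 :: "L2 \<Rightarrow> L2 \<Rightarrow> L2" is "\<lambda>f g z. f z - g z"
  by (auto simp: L2_eq_def intro: square_integrable_diff)

instance
proof
  fix a b c :: L2
  show "a + b + c = a + (b + c)"
    by transfer (auto simp: L2_eq_def add.assoc intro!: square_integrable_add)
  show "a + b = b + a"
    by transfer (auto simp: L2_eq_def add.commute intro!: square_integrable_add)
  show "0 + a = a"
    by transfer (auto simp: L2_eq_def)
  show "- a + a = 0"
    by transfer (auto simp: L2_eq_def square_integrable_zero)
  show "a - b = a + - b"
    by transfer (auto simp: L2_eq_def intro: square_integrable_diff)
qed

end

lift_definition scaleC_L2 :: "complex \<Rightarrow> L2 \<Rightarrow> L2" (infixr \<open>*\<^sub>C\<close> 75) is "\<lambda>c f z. c * f z"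
  by (auto simp: L2_eq_def intro: square_integrable_cmult)

lift_definition cinner_L2 :: "L2 \<Rightarrow> L2 \<Rightarrow> complex" is
  "\<lambda>f g. \<integral>z. f z * cnj (g z) \<partial>circle"
  by (rule integral_cong_AE)
     (auto simp: L2_eq_def square_integrable_def
       intro!: borel_measurable_times borel_measurable_cnj_comp)

lift_definition fourier_coeff :: "L2 \<Rightarrow> int \<Rightarrow> complex" is
  "\<lambda>f n. \<integral>z. f z * cnj (z powi n) \<partial>circle"
  by (intro ext integral_cong_AE)
     (auto simp: L2_eq_def square_integrable_def simp del: complex_cnj_power_int
       intro!: borel_measurable_times borel_measurable_cnj_comp borel_measurable_powi_circle)

lift_definition flip :: "L2 \<Rightarrow> L2" is "\<lambda>f z. f (cnj z)"
proof -
  fix f g assume *: "L2_eq f g"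
  then have "AE z in circle. f (cnj z) = g (cnj z)"
    using AE_circle_cnj[of "\<lambda>z. f z = g z"] by (simp add: L2_eq_def)
  with * show "L2_eq (\<lambda>z. f (cnj z)) (\<lambda>z. g (cnj z))"
    by (simp add: L2_eq_def square_integrable_flip)
qed

text \<open>Multiplication by an essentially bounded symbol; for any other symbol the value is \<open>0\<close>
  by convention.\<close>

lift_definition mult_op :: "(complex \<Rightarrow> complex) \<Rightarrow> L2 \<Rightarrow> L2" is
  "\<lambda>\<phi> f z. if \<phi> \<in> L_infinity then \<phi> z * f z else 0"
proof -
  fix \<phi> f g assume "L2_eq f g"
  then show "L2_eq (\<lambda>z. if \<phi> \<in> L_infinity then \<phi> z * f z else 0)
      (\<lambda>z. if \<phi> \<in> L_infinity then \<phi> z * g z else 0)"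
    by (cases "\<phi> \<in> L_infinity")
       (auto simp: L2_eq_def square_integrable_zero intro: square_integrable_mult)
qed


section \<open>Subspaces, projections and operators\<close>

definition orth_compl :: "L2 set \<Rightarrow> L2 set" where
  "orth_compl M = {f. \<forall>g\<in>M. cinner_L2 f g = 0}"

definition orth_proj :: "L2 set \<Rightarrow> L2 \<Rightarrow> L2" where
  "orth_proj M f = (THE g. g \<in> M \<and> f - g \<in> orth_compl M)"

text \<open>The Hilbert space adjoint of an operator \<open>T\<close> that maps the subspace \<open>M\<close> to itself,
  evaluated at \<open>g \<in> M\<close>.\<close>

definition adjoint_on :: "L2 set \<Rightarrow> (L2 \<Rightarrow> L2) \<Rightarrow> L2 \<Rightarrow> L2" where
  "adjoint_on M T g = (THE k. k \<in> M \<and> (\<forall>h\<in>M. cinner_L2 (T h) g = cinner_L2 h k))"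

definition rank_one :: "L2 \<Rightarrow> L2 \<Rightarrow> L2 \<Rightarrow> L2" (infix \<open>\<otimes>\<close> 70) where
  "(f \<otimes> g) h = cinner_L2 h g *\<^sub>C f"

definition hardy :: "L2 set" where
  "hardy = {f. \<forall>n<0. fourier_coeff f n = 0}"

definition proj_P :: "L2 \<Rightarrow> L2" where
  "proj_P = orth_proj hardy"

definition proj_Q :: "L2 \<Rightarrow> L2" where
  "proj_Q f = f - proj_P f"

text \<open>An inner function and its boundary function are given together as one function on the closed
  disk: the values on the circle are almost everywhere the radial limits of those in the disk.\<close>

definition inner_function :: "(complex \<Rightarrow> complex) \<Rightarrow> bool" where
  "inner_function \<theta> \<longleftrightarrow>
     \<theta> holomorphic_on ball 0 1 \<and> bounded (\<theta> ` ball 0 1) \<and>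
     \<theta> \<in> borel_measurable circle \<and>
     (AE z in circle. ((\<lambda>r. \<theta> (of_real r * z)) \<longlongrightarrow> \<theta> z) (at_left 1)) \<and>
     (AE z in circle. cmod (\<theta> z) = 1)"

definition model_space :: "(complex \<Rightarrow> complex) \<Rightarrow> L2 set" where
  "model_space \<theta> = hardy \<inter> orth_compl (mult_op \<theta> ` hardy)"

definition model_compl :: "(complex \<Rightarrow> complex) \<Rightarrow> L2 set" where
  "model_compl \<theta> = orth_compl (model_space \<theta>)"

definition proj_Q\<theta> :: "(complex \<Rightarrow> complex) \<Rightarrow> L2 \<Rightarrow> L2" where
  "proj_Q\<theta> \<theta> f = proj_Q f + mult_op \<theta> (proj_P (mult_op (\<lambda>z. cnj (\<theta> z)) f))"

text \<open>Both operators act on \<open>model_compl \<theta>\<close>; their values elsewhere are irrelevant.\<close>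

definition dual_trunc_hankel ::
  "(complex \<Rightarrow> complex) \<Rightarrow> (complex \<Rightarrow> complex) \<Rightarrow> L2 \<Rightarrow> L2" where
  "dual_trunc_hankel \<theta> \<phi> h = proj_Q\<theta> \<theta> (flip (mult_op \<phi> h))"

definition compressed_shift :: "(complex \<Rightarrow> complex) \<Rightarrow> L2 \<Rightarrow> L2" where
  "compressed_shift \<theta> h = proj_Q\<theta> \<theta> (mult_op (\<lambda>z. z) h)"

definition star :: "(complex \<Rightarrow> complex) \<Rightarrow> complex \<Rightarrow> complex" where
  "star \<phi> z = cnj (\<phi> (cnj z))"

definition alpha :: "(complex \<Rightarrow> complex) \<Rightarrow> (complex \<Rightarrow> complex) \<Rightarrow> L2" where
  "alpha \<theta> \<phi> = L2_class (\<lambda>z. \<phi> z * (1 - cnj (fourier_coeff (L2_class \<theta>) 0) * \<theta> z))"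

end

theory Submission
  imports Defs "HOL-Complex_Analysis.Cauchy_Integral_Formula"
begin

text \<open>
  Write \<open>M\<close> for \<open>model_compl \<theta>\<close>, \<open>K\<close> for \<open>model_space \<theta>\<close>, \<open>Q\<^sub>\<theta>\<close> for the projection onto \<open>M\<close>,
  \<open>J\<close> for the flip, and \<open>S\<close> for multiplication by \<open>cnj\<close>, that is, by the inverse of \<open>z\<close>. Since
  \<open>J(\<phi> z h) = S(J(\<phi> h))\<close>, both terms on the left would cancel if the shifts were not compressed: with
  \<open>g = J(\<phi> h)\<close> each of them would be \<open>Q\<^sub>\<theta>(S g)\<close>. What remains is the effect of the two compressions,
  and each of these has rank one.

  The source of both is one property of the model space: for \<open>k \<in> K\<close>, the function \<open>S k\<close> is again
  in \<open>K\<close> up to the multiple \<open>k(0)\<close> of \<open>cnj \<in> M\<close> (\<open>backward_shift_model_space\<close>). The value \<open>k(0)\<close> is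
  the inner product of \<open>k\<close> with the element \<open>1 - cnj \<theta>(0) * \<theta>\<close> of \<open>K\<close>, called \<open>kernel0 \<theta>\<close> below. Hence
  \<open>Q\<^sub>\<theta>\<close> removes from \<open>z h\<close>, for \<open>h \<in> M\<close>, exactly the multiple \<open>\<langle>h, cnj\<rangle>\<close> of \<open>kernel0 \<theta>\<close>
  (\<open>compressed_shift_eq\<close>), which produces the second rank-one operator of the theorem. Dually,
  \<open>Q\<^sub>\<theta>(S(g - Q\<^sub>\<theta> g))\<close> is the multiple \<open>\<langle>g, kernel0 \<theta>\<rangle>\<close> of \<open>cnj\<close> (\<open>proj_Q\<theta>_zbar_defect\<close>), and moving
  \<open>J\<close> and \<open>\<phi>\<close> to the other side of this inner product turns \<open>kernel0 \<theta>\<close> into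
  \<open>flip (alpha \<theta> (star \<phi>))\<close>, which produces the first one.

  Two analytic facts support this algebra. First, the projection onto the Hardy space is defined by
  a description and has to be shown to exist: \<open>L2\<close> is made a real inner product space, it is
  complete by the Riesz-Fischer argument, and closed subspaces of complete inner product spaces have
  orthogonal projections. Secondly, \<open>\<theta>\<close> maps the Hardy space to itself. For this the boundary
  function is replaced by the dilations \<open>\<theta>(r z)\<close>, \<open>r < 1\<close>, which are given by absolutely convergent
  power series, and \<open>r\<close> tends to \<open>1\<close> by dominated convergence.
\<close>

section \<open>\<open>L2\<close> as an inner product space\<close>

lemma L2_eq_refl: "square_integrable f \<Longrightarrow> L2_eq f f"
  by (simp add: L2_eq_def)

lemma L2_cases:
  obtains f where "square_integrable f" "x = L2_class f"
proof -
  have "L2_eq (rep_L2 x) (rep_L2 x)" "L2_class (rep_L2 x) = x"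
    using Quotient_rep_reflp[OF Quotient_L2] Quotient_abs_rep[OF Quotient_L2] by blast+
  then show thesis using that[of "rep_L2 x"] by (simp add: L2_eq_def)
qed

lemma L2_class_eqI:
  assumes "square_integrable f" "square_integrable g" "AE z in circle. f z = g z"
  shows "L2_class f = L2_class g"
  using assms Quotient_rel_abs[OF Quotient_L2] by (simp add: L2_eq_def)

lemma square_integrable_measurable: "square_integrable f \<Longrightarrow> f \<in> borel_measurable circle"
  by (simp add: square_integrable_def)

lemma L2_class_diff:
  "square_integrable f \<Longrightarrow> square_integrable g \<Longrightarrow>
    L2_class f - L2_class g = L2_class (\<lambda>z. f z - g z)"
  by (simp add: minus_L2.abs_eq L2_eq_refl)

lemma L2_class_scaleC:
  "square_integrable f \<Longrightarrow> c *\<^sub>C L2_class f = L2_class (\<lambda>z. c * f z)"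
  by (simp add: scaleC_L2.abs_eq L2_eq_refl)

lemma cinner_L2_class:
  "square_integrable f \<Longrightarrow> square_integrable g \<Longrightarrow>
    cinner_L2 (L2_class f) (L2_class g) = (\<integral>z. f z * cnj (g z) \<partial>circle)"
  by (simp add: cinner_L2.abs_eq L2_eq_refl)

lemma mult_op_L2_class:
  "\<phi> \<in> L_infinity \<Longrightarrow> square_integrable f \<Longrightarrow>
    mult_op \<phi> (L2_class f) = L2_class (\<lambda>z. \<phi> z * f z)"
  by (simp add: mult_op.abs_eq L2_eq_refl)

lemma flip_L2_class:
  "square_integrable f \<Longrightarrow> flip (L2_class f) = L2_class (\<lambda>z. f (cnj z))"
  by (simp add: flip.abs_eq L2_eq_refl)

lemma integrable_mult_cnj:
  assumes "square_integrable f" "square_integrable g"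
  shows "integrable circle (\<lambda>z. f z * cnj (g z))"
proof (rule Bochner_Integration.integrable_bound)
  show "integrable circle (\<lambda>z. (cmod (f z))\<^sup>2 + (cmod (g z))\<^sup>2)"
    using assms by (auto simp: square_integrable_def)
  show "(\<lambda>z. f z * cnj (g z)) \<in> borel_measurable circle"
    using assms
    by (auto simp: square_integrable_def intro!: borel_measurable_times borel_measurable_cnj_comp)
  have "a * b \<le> a\<^sup>2 + b\<^sup>2" if "0 \<le> a" "0 \<le> b" for a b :: real
  proof -
    have "0 \<le> (a - b)\<^sup>2" by simp
    moreover have "0 \<le> a * b" using that by simp
    ultimately show ?thesis by (simp add: power2_diff)
  qed
  then show "AE z in circle. norm (f z * cnj (g z)) \<le> norm ((cmod (f z))\<^sup>2 + (cmod (g z))\<^sup>2)"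
    by (intro AE_I2) (simp add: norm_mult)
qed

lemma cinner_add_left: "cinner_L2 (x + y) w = cinner_L2 x w + cinner_L2 y w"
  by transfer (simp add: L2_eq_def distrib_right integrable_mult_cnj)

lemma cinner_scaleC_left: "cinner_L2 (c *\<^sub>C x) y = c * cinner_L2 x y"
  by transfer (simp add: mult.assoc)

lemma cinner_commute: "cinner_L2 y x = cnj (cinner_L2 x y)"
proof transfer
  fix f g
  have "(\<integral>z. g z * cnj (f z) \<partial>circle) = (\<integral>z. cnj (f z * cnj (g z)) \<partial>circle)"
    by (simp add: mult.commute)
  also have "\<dots> = cnj (\<integral>z. f z * cnj (g z) \<partial>circle)"
    by (rule Bochner_Integration.integral_cnj)
  finally show "(\<integral>z. g z * cnj (f z) \<partial>circle) = cnj (\<integral>z. f z * cnj (g z) \<partial>circle)" .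
qed

lemma scaleC_assoc: "a *\<^sub>C (b *\<^sub>C x) = (a * b) *\<^sub>C x"
  by transfer (auto simp: L2_eq_def mult.assoc intro: square_integrable_cmult)

lemma scaleC_add_right: "a *\<^sub>C (x + y) = a *\<^sub>C x + a *\<^sub>C y"
  by transfer (auto simp: L2_eq_def distrib_left intro!: square_integrable_cmult square_integrable_add)

lemma scaleC_add_left: "(a + b) *\<^sub>C x = a *\<^sub>C x + b *\<^sub>C x"
  by transfer (auto simp: L2_eq_def distrib_right intro!: square_integrable_cmult square_integrable_add)

lemma scaleC_one: "1 *\<^sub>C x = x"
  by transfer (auto simp: L2_eq_def)

lemma cinner_self_nonneg: "0 \<le> Re (cinner_L2 x x)"
proof transfer
  fix f assume "L2_eq f f"
  have "(\<integral>z. f z * cnj (f z) \<partial>circle) = (\<integral>z. of_real ((cmod (f z))\<^sup>2) \<partial>circle)"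
    by (simp only: complex_norm_square)
  then show "0 \<le> Re (\<integral>z. f z * cnj (f z) \<partial>circle)"
    by (simp only: integral_complex_of_real) simp
qed

lemma Re_cinner_self_L2_class:
  assumes "square_integrable f"
  shows "Re (cinner_L2 (L2_class f) (L2_class f)) = (\<integral>z. (cmod (f z))\<^sup>2 \<partial>circle)"
proof -
  have "(\<integral>z. f z * cnj (f z) \<partial>circle) = (\<integral>z. of_real ((cmod (f z))\<^sup>2) \<partial>circle)"
    by (simp only: complex_norm_square)
  then show ?thesis
    using assms by (simp only: cinner_L2_class integral_complex_of_real) simp
qed

lemma cinner_self_eq_0D:
  assumes "Re (cinner_L2 x x) = 0"
  shows "x = 0"
proof -
  obtain f where f: "square_integrable f" "x = L2_class f" by (rule L2_cases)
  have "(\<integral>z. (cmod (f z))\<^sup>2 \<partial>circle) = 0"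
    using assms f Re_cinner_self_L2_class by simp
  then have "AE z in circle. (cmod (f z))\<^sup>2 = 0"
    using f by (subst (asm) integral_nonneg_eq_0_iff_AE) (auto simp: square_integrable_def)
  then have "L2_class f = L2_class (\<lambda>z. 0)"
    using f square_integrable_zero by (intro L2_class_eqI) auto
  then show ?thesis using f by (simp add: zero_L2_def)
qed

text \<open>The real structure, with the real part of the inner product, makes the library's metric notions
  available. A closed complex subspace is in particular a closed real one, so this structure
  suffices for finding projections.\<close>

instantiation L2 :: real_inner
begin

definition scaleR_L2 :: "real \<Rightarrow> L2 \<Rightarrow> L2" where "r *\<^sub>R x = complex_of_real r *\<^sub>C x"
definition inner_L2 :: "L2 \<Rightarrow> L2 \<Rightarrow> real" where "x \<bullet> y = Re (cinner_L2 x y)"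
definition norm_L2 :: "L2 \<Rightarrow> real" where "norm (x::L2) = sqrt (x \<bullet> x)"
definition dist_L2 :: "L2 \<Rightarrow> L2 \<Rightarrow> real" where "dist (x::L2) y = norm (x - y)"
definition sgn_L2 :: "L2 \<Rightarrow> L2" where "sgn (x::L2) = scaleR (inverse (norm x)) x"
definition uniformity_L2 :: "(L2 \<times> L2) filter" where
  "uniformity_L2 = (INF e\<in>{0<..}. principal {(x, y). dist x y < e})"
definition open_L2 :: "L2 set \<Rightarrow> bool" where
  "open_L2 U = (\<forall>x\<in>U. \<forall>\<^sub>F (x', y) in uniformity. x' = x \<longrightarrow> y \<in> U)"

instance
proof
  fix a b :: real and x y w :: L2
  show "a *\<^sub>R (x + y) = a *\<^sub>R x + a *\<^sub>R y" by (simp add: scaleR_L2_def scaleC_add_right)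
  show "(a + b) *\<^sub>R x = a *\<^sub>R x + b *\<^sub>R x" by (simp add: scaleR_L2_def scaleC_add_left)
  show "a *\<^sub>R b *\<^sub>R x = (a * b) *\<^sub>R x" by (simp add: scaleR_L2_def scaleC_assoc)
  show "1 *\<^sub>R x = x" by (simp add: scaleR_L2_def scaleC_one)
  show "dist x y = norm (x - y)" by (rule dist_L2_def)
  show "sgn x = inverse (norm x) *\<^sub>R x" by (simp add: sgn_L2_def)
  show "(uniformity :: (L2 \<times> L2) filter) = (INF e\<in>{0<..}. principal {(x, y). dist x y < e})"
    by (rule uniformity_L2_def)
  show "x \<bullet> y = y \<bullet> x" by (simp add: inner_L2_def cinner_commute[of y x])
  show "(x + y) \<bullet> w = x \<bullet> w + y \<bullet> w" by (simp add: inner_L2_def cinner_add_left)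
  show "(a *\<^sub>R x) \<bullet> y = a * (x \<bullet> y)"
    by (simp add: inner_L2_def scaleR_L2_def cinner_scaleC_left)
  show "0 \<le> x \<bullet> x" by (simp add: inner_L2_def cinner_self_nonneg)
  have "cinner_L2 0 0 = (0::complex)" by transfer simp
  then show "(x \<bullet> x = 0) = (x = 0)" by (auto simp: inner_L2_def cinner_self_eq_0D)
  show "norm x = sqrt (x \<bullet> x)" by (rule norm_L2_def)
  show "open U = (\<forall>x\<in>U. \<forall>\<^sub>F (x', y) in uniformity. x' = x \<longrightarrow> y \<in> U)" for U :: "L2 set"
    by (rule open_L2_def)
qed

end


section \<open>Completeness\<close>

lemma emeasure_circle: "emeasure circle (space circle) = 1"
proof -
  have "emeasure circle (space circle) = emeasure (uniform_measure lborel {-pi..pi}) (cis -` sphere 0 1)"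
    unfolding circle_def using emeasure_distr[OF measurable_cis_circle, of "sphere 0 1"]
      sets.top[of "restrict_space borel (sphere (0::complex) 1)"]
    by (simp add: space_restrict_space del: sets.top)
  also have "cis -` sphere 0 1 = UNIV" by auto
  also have "emeasure (uniform_measure lborel {-pi..pi}) UNIV = 1"
    by (simp add: emeasure_uniform_measure)
  finally show ?thesis .
qed

lemma finite_measure_circle: "finite_measure circle"
  by standard (simp add: emeasure_circle del: space_circle)

lemma norm_L2_class:
  assumes "square_integrable f"
  shows "(norm (L2_class f))\<^sup>2 = (\<integral>z. (cmod (f z))\<^sup>2 \<partial>circle)"
  using Re_cinner_self_L2_class[OF assms]
  by (simp add: power2_norm_eq_inner inner_L2_def)

lemma square_integrable_L_infinity:
  assumes "f \<in> L_infinity" shows "square_integrable f"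
  using square_integrable_mult[OF assms, of "\<lambda>z. 1"]
    finite_measure.integrable_const[OF finite_measure_circle, of "1::real"]
  by (auto simp: square_integrable_def)

lemma square_integrable_ennrealI:
  assumes [measurable]: "f \<in> borel_measurable circle"
    and "(\<integral>\<^sup>+z. ennreal ((cmod (f z))\<^sup>2) \<partial>circle) \<le> ennreal C"
  shows "square_integrable f"
  using assms unfolding square_integrable_def
  by (auto intro!: integrableI_nonneg elim: le_less_trans)

text \<open>The increments have summable \<open>L\<^sup>2\<close> norms, hence summable \<open>L\<^sup>1\<close> norms because the measure is
  finite. By monotone convergence the series of their moduli is then integrable, so it is finite
  almost everywhere and the telescoping series converges.\<close>

lemma AE_convergent_of_fast_Cauchy:
  assumes f: "\<And>n. square_integrable (f n)"
    and fast: "\<And>n. norm (L2_class (f (Suc n)) - L2_class (f n)) \<le> (1/2) ^ n"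
  shows "AE z in circle. convergent (\<lambda>n. f n z)"
proof -
  interpret finite_measure circle by (rule finite_measure_circle)
  define d where "d n z = cmod (f (Suc n) z - f n z)" for n z
  have f': "f n \<in> borel_measurable circle" for n
    using f square_integrable_measurable by blast
  note [measurable] = f'
  have dm [measurable]: "d n \<in> borel_measurable circle" for n
    unfolding d_def by measurable
  have d0: "0 \<le> d n z" for n z
    by (simp add: d_def)
  have d2: "integrable circle (\<lambda>z. (d n z)\<^sup>2)" and d2_le: "(\<integral>z. (d n z)\<^sup>2 \<partial>circle) \<le> ((1/2) ^ n)\<^sup>2" for n
  proof -
    have s: "square_integrable (\<lambda>z. f (Suc n) z - f n z)"
      by (intro square_integrable_diff f)
    then show "integrable circle (\<lambda>z. (d n z)\<^sup>2)"
      by (simp add: square_integrable_def d_def)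
    have "(norm (L2_class (f (Suc n)) - L2_class (f n)))\<^sup>2 \<le> ((1/2) ^ n)\<^sup>2"
      by (intro power_mono fast) auto
    then show "(\<integral>z. (d n z)\<^sup>2 \<partial>circle) \<le> ((1/2) ^ n)\<^sup>2"
      using norm_L2_class[OF s] by (simp add: L2_class_diff f d_def)
  qed
  \<comment> \<open>This replaces the Cauchy-Schwarz inequality in comparing the two norms of \<open>d n\<close>.\<close>
  have bound: "d n z \<le> (1/2) ^ n + 2 ^ n * (d n z)\<^sup>2" for n z
  proof (cases "d n z \<le> (1/2) ^ n")
    case True
    then show ?thesis by (simp add: add_increasing2)
  next
    case False
    have "d n z = 2 ^ n * ((1/2) ^ n * d n z)" by (simp add: power_one_over)
    also have "\<dots> \<le> 2 ^ n * (d n z * d n z)"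
      using False by (intro mult_left_mono mult_right_mono) (auto simp: d_def)
    finally show ?thesis by (simp add: power2_eq_square add_increasing)
  qed
  have dint: "integrable circle (d n)" for n
    by (rule Bochner_Integration.integrable_bound[of _ "\<lambda>z. (1/2) ^ n + 2 ^ n * (d n z)\<^sup>2"])
      (use d2 bound in \<open>auto simp: d_def\<close>)
  have "(\<integral>z. d n z \<partial>circle) \<le> 2 * (1/2) ^ n" for n
  proof -
    have "(\<integral>z. d n z \<partial>circle) \<le> (\<integral>z. (1/2) ^ n + 2 ^ n * (d n z)\<^sup>2 \<partial>circle)"
      using d2 dint bound by (intro integral_mono) auto
    also have "\<dots> = (1/2) ^ n + 2 ^ n * (\<integral>z. (d n z)\<^sup>2 \<partial>circle)"
      using d2 emeasure_circle by (simp add: measure_def)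
    also have "\<dots> \<le> (1/2) ^ n + 2 ^ n * ((1/2) ^ n)\<^sup>2"
      using d2_le by simp
    also have "\<dots> = 2 * (1/2) ^ n"
      by (simp add: power2_eq_square power_one_over)
    finally show ?thesis .
  qed
  then have "(\<integral>\<^sup>+z. ennreal (d n z) \<partial>circle) \<le> ennreal (2 * (1/2) ^ n)" for n
    using dint by (subst nn_integral_eq_integral) (auto simp: d0 intro!: ennreal_leI)
  then have "(\<Sum>n. \<integral>\<^sup>+z. ennreal (d n z) \<partial>circle) \<le> (\<Sum>n. ennreal (2 * (1/2) ^ n))"
    by (intro suminf_le) auto
  also have "\<dots> = ennreal (\<Sum>n. 2 * (1/2) ^ n)"
    by (intro suminf_ennreal2) (auto intro!: summable_mult summable_geometric)
  finally have "(\<integral>\<^sup>+z. (\<Sum>n. ennreal (d n z)) \<partial>circle) \<noteq> \<infinity>"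
    by (subst nn_integral_suminf) (auto simp: top_unique)
  then have "AE z in circle. (\<Sum>n. ennreal (d n z)) \<noteq> \<infinity>"
    by (intro nn_integral_noteq_infinite) auto
  then show ?thesis
  proof eventually_elim
    case (elim z)
    then have "summable (\<lambda>n. d n z)"
      by (intro summable_suminf_not_top) (auto simp: d_def)
    then have "summable (\<lambda>n. f (Suc n) z - f n z)"
      unfolding d_def by (rule summable_norm_cancel)
    then have "(\<lambda>n. \<Sum>i<n. f (Suc i) z - f i z) \<longlonglongrightarrow> (\<Sum>n. f (Suc n) z - f n z)"
      by (rule summable_LIMSEQ)
    then have "(\<lambda>n. f n z - f 0 z + f 0 z) \<longlonglongrightarrow> (\<Sum>n. f (Suc n) z - f n z) + f 0 z"
      using sum_lessThan_telescope[of "\<lambda>n. f n z"] by (intro tendsto_intros) simp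
    then show ?case
      unfolding convergent_def by auto
  qed
qed

text \<open>Riesz-Fischer: a rapidly convergent subsequence converges almost everywhere to some \<open>g\<close>, and
  Fatou's lemma carries the estimates between members of the subsequence over to \<open>g\<close>.\<close>

instance L2 :: complete_space
proof
  fix X :: "nat \<Rightarrow> L2" assume X: "Cauchy X"
  have "\<forall>n. \<exists>N. \<forall>i\<ge>N. \<forall>j\<ge>N. dist (X i) (X j) < (1/2) ^ n"
    using X unfolding Cauchy_def by (auto simp: zero_less_power)
  then obtain N where N: "\<And>n i j. i \<ge> N n \<Longrightarrow> j \<ge> N n \<Longrightarrow> dist (X i) (X j) < (1/2) ^ n"
    by metis
  \<comment> \<open>The summand \<open>n\<close> makes \<open>r\<close> strictly increasing; the sum keeps it above every \<open>N n\<close>.\<close>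
  define r where "r n = n + (\<Sum>i\<le>n. N i)" for n
  have r: "strict_mono r"
    unfolding strict_mono_Suc_iff r_def by simp
  have rN: "N n \<le> r n" for n
  proof -
    have "N n \<le> (\<Sum>i\<le>n. N i)" by (rule member_le_sum) auto
    then show ?thesis by (simp add: r_def)
  qed
  have r_mono: "r n \<le> r m" if "n \<le> m" for n m
    using r that by (simp add: strict_mono_less_eq)
  have close: "norm (X (r m) - X (r n)) \<le> (1/2) ^ n" if "n \<le> m" for m n
    using N[of n "r m" "r n"] rN[of n] r_mono[OF that] by (simp add: dist_norm)
  have "\<exists>f. square_integrable f \<and> X (r n) = L2_class f" for n
    using L2_cases by blast
  then obtain f where f: "\<And>n. square_integrable (f n)" and Xf: "\<And>n. X (r n) = L2_class (f n)"
    by metis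
  have fm [measurable]: "f n \<in> borel_measurable circle" for n
    using f square_integrable_measurable by blast
  define g where "g z = lim (\<lambda>n. f n z)" for z
  have gm [measurable]: "g \<in> borel_measurable circle"
    unfolding g_def by (rule borel_measurable_lim_metric) measurable
  have "AE z in circle. convergent (\<lambda>n. f n z)"
    using close[of _ "Suc _"] by (intro AE_convergent_of_fast_Cauchy f) (simp add: Xf)
  then have fg: "AE z in circle. (\<lambda>n. f n z) \<longlonglongrightarrow> g z"
    by (simp add: g_def convergent_LIMSEQ_iff)
  have g_close: "(\<integral>\<^sup>+z. ennreal ((cmod (g z - f n z))\<^sup>2) \<partial>circle) \<le> ennreal (((1/2) ^ n)\<^sup>2)" for n
  proof -
    have "(\<integral>\<^sup>+z. ennreal ((cmod (g z - f n z))\<^sup>2) \<partial>circle)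
        = (\<integral>\<^sup>+z. liminf (\<lambda>m. ennreal ((cmod (f m z - f n z))\<^sup>2)) \<partial>circle)"
    proof (rule nn_integral_cong_AE, use fg in eventually_elim)
      case (elim z)
      then have "(\<lambda>m. ennreal ((cmod (f m z - f n z))\<^sup>2)) \<longlonglongrightarrow> ennreal ((cmod (g z - f n z))\<^sup>2)"
        by (intro tendsto_ennrealI tendsto_intros)
      from lim_imp_Liminf[OF _ this] show ?case
        by simp
    qed
    also have "\<dots> \<le> liminf (\<lambda>m. \<integral>\<^sup>+z. ennreal ((cmod (f m z - f n z))\<^sup>2) \<partial>circle)"
      by (rule nn_integral_liminf) measurable
    also have "\<dots> \<le> limsup (\<lambda>m. \<integral>\<^sup>+z. ennreal ((cmod (f m z - f n z))\<^sup>2) \<partial>circle)"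
      by (rule Liminf_le_Limsup) simp
    also have "\<dots> \<le> ennreal (((1/2) ^ n)\<^sup>2)"
    proof (rule Limsup_bounded, rule eventually_sequentiallyI)
      fix m assume "n \<le> m"
      have s: "square_integrable (\<lambda>z. f m z - f n z)"
        by (intro square_integrable_diff f)
      have "(\<integral>\<^sup>+z. ennreal ((cmod (f m z - f n z))\<^sup>2) \<partial>circle)
          = ennreal ((norm (X (r m) - X (r n)))\<^sup>2)"
        unfolding Xf L2_class_diff[OF f f] norm_L2_class[OF s]
        using s by (intro nn_integral_eq_integral) (auto simp: square_integrable_def)
      also have "\<dots> \<le> ennreal (((1/2) ^ n)\<^sup>2)"
        using close[OF \<open>n \<le> m\<close>] by (intro ennreal_leI power_mono) auto
      finally show "(\<integral>\<^sup>+z. ennreal ((cmod (f m z - f n z))\<^sup>2) \<partial>circle) \<le> ennreal (((1/2) ^ n)\<^sup>2)" .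
    qed
    finally show ?thesis .
  qed
  have gf: "square_integrable (\<lambda>z. g z - f n z)" for n
    using g_close by (intro square_integrable_ennrealI) measurable
  have g: "square_integrable g"
    using square_integrable_add[OF gf[of 0] f[of 0]] by simp
  have "dist (X (r n)) (L2_class g) \<le> (1/2) ^ n" for n
  proof -
    have "(\<integral>z. (cmod (g z - f n z))\<^sup>2 \<partial>circle) \<le> ((1/2) ^ n)\<^sup>2"
      using g_close[of n] gf[of n]
      by (subst (asm) nn_integral_eq_integral) (auto simp: square_integrable_def ennreal_le_iff)
    then have "(norm (L2_class g - X (r n)))\<^sup>2 \<le> ((1/2) ^ n)\<^sup>2"
      using norm_L2_class[OF gf[of n]] by (simp add: Xf L2_class_diff f g)
    then show ?thesis
      by (simp add: dist_commute dist_norm power2_le_iff_abs_le)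
  qed
  then have "(\<lambda>n. dist (X (r n)) (L2_class g)) \<longlonglongrightarrow> 0"
    by (intro tendsto_sandwich[OF always_eventually always_eventually tendsto_const
          LIMSEQ_realpow_zero[of "1/2"]]) auto
  then have "(X \<circ> r) \<longlonglongrightarrow> L2_class g"
    by (simp add: tendsto_dist_iff[of "X \<circ> r"])
  with X r have "X \<longlonglongrightarrow> L2_class g"
    by (rule Cauchy_converges_subseq)
  then show "convergent X" by (rule convergentI)
qed


section \<open>Orthogonal projections\<close>

text \<open>A sequence in \<open>M\<close> whose distances from \<open>x\<close> tend to \<open>infdist x M\<close> is Cauchy, because the
  midpoint of two of its members lies in \<open>M\<close> and the parallelogram law then bounds their distance.
  Its limit \<open>p\<close> is nearest to \<open>x\<close>, and a nearest point leaves a remainder orthogonal to \<open>M\<close>.\<close>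

lemma ex_orthogonal_projection:
  fixes M :: "'a::{real_inner,complete_space} set"
  assumes "subspace M" "closed M"
  shows "\<exists>p\<in>M. \<forall>y\<in>M. (x - p) \<bullet> y = 0"
proof -
  define D where "D = infdist x M"
  have ne: "M \<noteq> {}" using subspace_0[OF assms(1)] by auto
  have D_le: "D \<le> norm (x - y)" if "y \<in> M" for y
    using infdist_le[OF that, of x] by (simp add: D_def dist_norm)
  have D0: "0 \<le> D" by (simp add: D_def infdist_nonneg)
  have "\<exists>y\<in>M. norm (x - y) < D + 1 / real (Suc n)" for n
  proof -
    have False if "\<And>y. y \<in> M \<Longrightarrow> D + 1 / real (Suc n) \<le> norm (x - y)"
    proof -
      have "D + 1 / real (Suc n) \<le> D"
        unfolding D_def infdist_notempty[OF ne] using ne that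
        by (intro cINF_greatest) (auto simp: D_def infdist_notempty dist_norm)
      then show False by simp
    qed
    then show ?thesis by (meson not_le_imp_less)
  qed
  then obtain s where sM: "\<And>n. s n \<in> M" and s: "\<And>n. norm (x - s n) < D + 1 / real (Suc n)"
    by metis
  have gap: "(norm (s m - s n))\<^sup>2 \<le> 2 * (norm (x - s m))\<^sup>2 + 2 * (norm (x - s n))\<^sup>2 - 4 * D\<^sup>2" for m n
  proof -
    have "(1/2) *\<^sub>R (s m + s n) \<in> M"
      using assms(1) sM by (intro subspace_scale subspace_add)
    then have "D \<le> norm (x - (1/2) *\<^sub>R (s m + s n))" by (rule D_le)
    then have "D\<^sup>2 \<le> (norm (x - (1/2) *\<^sub>R (s m + s n)))\<^sup>2"
      using D0 by (intro power_mono)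
    then show ?thesis
      by (simp add: power2_norm_eq_inner algebra_simps inner_commute)
  qed
  have sq: "(\<lambda>n. (norm (x - s n))\<^sup>2) \<longlonglongrightarrow> D\<^sup>2"
  proof (rule tendsto_power, rule tendsto_sandwich)
    show "\<forall>\<^sub>F n in sequentially. D \<le> norm (x - s n)" using D_le sM by auto
    show "\<forall>\<^sub>F n in sequentially. norm (x - s n) \<le> D + 1 / real (Suc n)"
      by (intro always_eventually allI less_imp_le s)
    show "(\<lambda>n. D + 1 / real (Suc n)) \<longlonglongrightarrow> D"
      using tendsto_add[OF tendsto_const[of D] LIMSEQ_inverse_real_of_nat] by (simp add: inverse_eq_divide)
  qed simp
  have "Cauchy s"
  proof (rule metric_CauchyI)
    fix e :: real assume e: "0 < e"
    then have "\<forall>\<^sub>F n in sequentially. (norm (x - s n))\<^sup>2 < D\<^sup>2 + e\<^sup>2 / 4"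
      by (intro order_tendstoD(2)[OF sq]) simp
    then obtain N where N: "\<And>n. n \<ge> N \<Longrightarrow> (norm (x - s n))\<^sup>2 < D\<^sup>2 + e\<^sup>2 / 4"
      by (auto simp: eventually_sequentially)
    have "dist (s m) (s n) < e" if "m \<ge> N" "n \<ge> N" for m n
    proof -
      have "(norm (s m - s n))\<^sup>2 < e\<^sup>2"
        using gap[of m n] N[OF that(1)] N[OF that(2)] by simp
      then show ?thesis using e by (simp add: dist_norm power2_less_imp_less)
    qed
    then show "\<exists>N. \<forall>m\<ge>N. \<forall>n\<ge>N. dist (s m) (s n) < e" by blast
  qed
  then obtain p where p: "s \<longlonglongrightarrow> p"
    using Cauchy_convergent convergent_def by blast
  have pM: "p \<in> M"
    using assms(2) sM p closed_sequentially by blast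
  have "(\<lambda>n. (norm (x - s n))\<^sup>2) \<longlonglongrightarrow> (norm (x - p))\<^sup>2"
    by (intro tendsto_intros p)
  then have pD: "(norm (x - p))\<^sup>2 = D\<^sup>2" using sq LIMSEQ_unique by blast
  have "(x - p) \<bullet> y = 0" if y: "y \<in> M" for y
  proof (cases "y = 0")
    case False
    \<comment> \<open>This \<open>t\<close> minimizes the distance from \<open>x\<close> to \<open>p + t *\<^sub>R y\<close>.\<close>
    define t where "t = ((x - p) \<bullet> y) / (y \<bullet> y)"
    have "p + t *\<^sub>R y \<in> M"
      using assms(1) pM y by (intro subspace_add subspace_scale)
    then have "D\<^sup>2 \<le> (norm (x - (p + t *\<^sub>R y)))\<^sup>2"
      using D0 D_le by (intro power_mono) auto
    also have "\<dots> = (norm ((x - p) - t *\<^sub>R y))\<^sup>2" by (simp add: diff_diff_add)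
    also have "\<dots> = (norm (x - p))\<^sup>2 - 2 * t * ((x - p) \<bullet> y) + t\<^sup>2 * (y \<bullet> y)"
      unfolding power2_norm_eq_inner
      by (simp add: inner_diff_left inner_diff_right inner_commute power2_eq_square algebra_simps)
    also have "\<dots> = D\<^sup>2 - ((x - p) \<bullet> y)\<^sup>2 / (y \<bullet> y)"
      using False pD by (simp add: t_def power2_eq_square field_simps)
    finally have "((x - p) \<bullet> y)\<^sup>2 / (y \<bullet> y) \<le> 0" by simp
    then show ?thesis
      using False by (auto simp: divide_le_0_iff inner_gt_zero_iff[symmetric] simp del: inner_gt_zero_iff)
  qed simp
  then show ?thesis using pM by blast
qed

lemma cinner_add_right: "cinner_L2 w (x + y) = cinner_L2 w x + cinner_L2 w y"
  by (metis cinner_add_left cinner_commute complex_cnj_add)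

lemma cinner_scaleC_right: "cinner_L2 x (c *\<^sub>C y) = cnj c * cinner_L2 x y"
  by (metis cinner_scaleC_left cinner_commute complex_cnj_mult)

lemma cinner_zero_left: "cinner_L2 0 x = 0"
  using cinner_add_left[of 0 0 x] by simp

lemma cinner_zero_right: "cinner_L2 x 0 = 0"
  by (metis cinner_zero_left cinner_commute complex_cnj_zero)

lemma cinner_diff_left: "cinner_L2 (x - y) w = cinner_L2 x w - cinner_L2 y w"
  using cinner_add_left[of "x - y" y w] by simp

lemma cinner_diff_right: "cinner_L2 w (x - y) = cinner_L2 w x - cinner_L2 w y"
  using cinner_add_right[of w "x - y" y] by simp

lemmas cinner_simps =
  cinner_add_left cinner_add_right cinner_diff_left cinner_diff_right
  cinner_scaleC_left cinner_scaleC_right cinner_zero_left cinner_zero_right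

lemma cinner_self_eq_0: "cinner_L2 x x = 0 \<Longrightarrow> x = 0"
  by (simp add: cinner_self_eq_0D)

lemma cinner_eq_0_commute: "cinner_L2 x y = 0 \<longleftrightarrow> cinner_L2 y x = 0"
  by (metis cinner_commute complex_cnj_zero_iff)

lemma continuous_cinner_left: "continuous_on UNIV (\<lambda>x. cinner_L2 x y)"
proof -
  \<comment> \<open>The complex inner product is assembled from two real ones, whose continuity is known.\<close>
  have "cinner_L2 x y = Complex (x \<bullet> y) (x \<bullet> (\<i> *\<^sub>C y))" for x
    by (simp add: inner_L2_def cinner_simps complex_eq_iff)
  then show ?thesis
    by (simp add: Complex_eq) (intro continuous_intros)
qed

definition csubspace :: "L2 set \<Rightarrow> bool" where
  "csubspace M \<longleftrightarrow> 0 \<in> M \<and> (\<forall>x\<in>M. \<forall>y\<in>M. x + y \<in> M) \<and> (\<forall>c. \<forall>x\<in>M. c *\<^sub>C x \<in> M)"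

lemma minus_L2_scaleC: "x - y = x + (-1) *\<^sub>C y" for x y :: L2
proof -
  have "y + (-1) *\<^sub>C y = 0"
    using scaleC_add_left[of 1 "-1" y] scaleC_add_left[of 0 0 y] by (simp add: scaleC_one)
  then show ?thesis
    by (metis add.commute add_diff_cancel_right' diff_add_cancel diff_add_eq diff_zero)
qed

lemma csubspace_diff: "csubspace M \<Longrightarrow> x \<in> M \<Longrightarrow> y \<in> M \<Longrightarrow> x - y \<in> M"
  by (simp add: csubspace_def minus_L2_scaleC)

lemma csubspace_orth_compl: "csubspace (orth_compl S)"
  by (simp add: csubspace_def orth_compl_def cinner_simps)

lemma closed_orth_compl: "closed (orth_compl S)"
proof -
  have "orth_compl S = (\<Inter>g\<in>S. (\<lambda>x. cinner_L2 x g) -` {0})"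
    by (auto simp: orth_compl_def)
  also have "closed \<dots>"
    using continuous_cinner_left by (intro closed_INT ballI closed_vimage) auto
  finally show ?thesis .
qed

lemma orth_projI:
  assumes "csubspace M" "g \<in> M" "f - g \<in> orth_compl M"
  shows "orth_proj M f = g"
  unfolding orth_proj_def
proof (rule the_equality)
  fix g' assume g': "g' \<in> M \<and> f - g' \<in> orth_compl M"
  have "g - g' \<in> M" using assms g' by (simp add: csubspace_diff)
  moreover have "(f - g') - (f - g) \<in> orth_compl M"
    using assms(3) g' by (blast intro: csubspace_diff csubspace_orth_compl)
  ultimately have "cinner_L2 (g - g') (g - g') = 0"
    by (simp add: orth_compl_def)
  then show "g' = g" using cinner_self_eq_0 by fastforce
qed (use assms in simp)

text \<open>The projection for the real structure is also the one for the complex structure: the imaginary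
  part of \<open>cinner_L2 v y\<close> is the real inner product of \<open>v\<close> with \<open>\<i> *\<^sub>C y\<close>, and \<open>\<i> *\<^sub>C y\<close> lies in \<open>M\<close>
  too.\<close>

lemma orth_proj_closed:
  assumes M: "csubspace M" "closed M"
  shows "orth_proj M f \<in> M \<and> f - orth_proj M f \<in> orth_compl M"
proof -
  have "subspace M"
    using M by (auto simp: subspace_def csubspace_def scaleR_L2_def)
  from ex_orthogonal_projection[OF this M(2)] obtain p
    where p: "p \<in> M" "\<And>y. y \<in> M \<Longrightarrow> (f - p) \<bullet> y = 0" by metis
  have "cinner_L2 (f - p) y = 0" if "y \<in> M" for y
  proof -
    have "\<i> *\<^sub>C y \<in> M" using M that by (simp add: csubspace_def)
    then show ?thesis
      using p(2)[OF that] p(2)[of "\<i> *\<^sub>C y"]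
      by (simp add: inner_L2_def cinner_scaleC_right complex_eq_iff)
  qed
  then have "f - p \<in> orth_compl M" by (simp add: orth_compl_def)
  with p orth_projI[OF M(1), of p f] show ?thesis by simp
qed

section \<open>Multiplication operators and the flip\<close>

lemma L_infinity_mult:
  assumes "f \<in> L_infinity" "g \<in> L_infinity"
  shows "(\<lambda>z. f z * g z) \<in> L_infinity"
proof -
  obtain C D where C: "AE z in circle. cmod (f z) \<le> C" and D: "AE z in circle. cmod (g z) \<le> D"
    using assms by (auto simp: L_infinity_def)
  have "AE z in circle. cmod (f z * g z) \<le> \<bar>C\<bar> * \<bar>D\<bar>"
    using C D by eventually_elim (auto simp: norm_mult intro!: mult_mono)
  with assms show ?thesis by (auto simp: L_infinity_def)
qed

lemma L_infinity_cnj: "f \<in> L_infinity \<Longrightarrow> (\<lambda>z. cnj (f z)) \<in> L_infinity"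
  by (auto simp: L_infinity_def intro: borel_measurable_cnj_comp)

lemma L_infinity_flip:
  assumes "f \<in> L_infinity"
  shows "(\<lambda>z. f (cnj z)) \<in> L_infinity"
proof -
  from assms have [measurable]: "f \<in> borel_measurable circle" by (simp add: L_infinity_def)
  obtain C where "AE z in circle. cmod (f z) \<le> C"
    using assms by (auto simp: L_infinity_def)
  then have "AE z in circle. cmod (f (cnj z)) \<le> C"
    using AE_circle_cnj[of "\<lambda>z. cmod (f z) \<le> C"] by simp
  moreover have "(\<lambda>z. f (cnj z)) \<in> borel_measurable circle" by measurable
  ultimately show ?thesis by (auto simp: L_infinity_def)
qed

lemma L_infinity_const: "(\<lambda>z. c) \<in> L_infinity"
  by (auto simp: L_infinity_def)

lemma L_infinity_id: "(\<lambda>z. z) \<in> L_infinity"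
  using borel_measurable_powi_circle[of 1] by (auto simp: L_infinity_def intro!: exI[of _ 1] AE_I2)

lemma L_infinity_cnj_id: "cnj \<in> L_infinity"
  using L_infinity_cnj[OF L_infinity_id] by simp

lemma L_infinity_powi: "(\<lambda>z. z powi n) \<in> L_infinity"
  using borel_measurable_powi_circle[of n]
  by (auto simp: L_infinity_def norm_power_int intro!: exI[of _ 1] AE_I2)

lemma mult_op_add: "mult_op \<phi> (x + y) = mult_op \<phi> x + mult_op \<phi> y"
  by (cases "\<phi> \<in> L_infinity"; transfer)
    (auto simp: L2_eq_def distrib_left square_integrable_mult square_integrable_add square_integrable_zero)

lemma mult_op_scaleC: "mult_op \<phi> (c *\<^sub>C x) = c *\<^sub>C mult_op \<phi> x"
  by (cases "\<phi> \<in> L_infinity"; transfer)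
    (auto simp: L2_eq_def mult.left_commute square_integrable_mult square_integrable_cmult square_integrable_zero)

lemma mult_op_diff: "mult_op \<phi> (x - y) = mult_op \<phi> x - mult_op \<phi> y"
  using mult_op_add[of \<phi> "x - y" y] by simp

lemma flip_add: "flip (x + y) = flip x + flip y"
  by transfer (auto simp: L2_eq_def intro!: square_integrable_flip square_integrable_add)

lemma flip_scaleC: "flip (c *\<^sub>C x) = c *\<^sub>C flip x"
  by transfer (auto simp: L2_eq_def intro!: square_integrable_flip square_integrable_cmult)

lemma flip_diff: "flip (x - y) = flip x - flip y"
  using flip_add[of "x - y" y] by simp

lemma mult_op_mult_op:
  assumes "\<phi> \<in> L_infinity" "\<psi> \<in> L_infinity"
  shows "mult_op \<phi> (mult_op \<psi> x) = mult_op (\<lambda>z. \<phi> z * \<psi> z) x"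
  using assms L_infinity_mult[OF assms]
  by (cases x rule: L2_cases) (simp add: mult_op_L2_class square_integrable_mult mult.assoc)

lemma mult_op_cong_AE:
  assumes "\<phi> \<in> L_infinity" "\<psi> \<in> L_infinity" "AE z in circle. \<phi> z = \<psi> z"
  shows "mult_op \<phi> x = mult_op \<psi> x"
proof -
  obtain f where f: "square_integrable f" "x = L2_class f" by (rule L2_cases)
  have "L2_class (\<lambda>z. \<phi> z * f z) = L2_class (\<lambda>z. \<psi> z * f z)"
    using assms(3) by (intro L2_class_eqI square_integrable_mult assms f) (auto elim: eventually_mono)
  with f assms show ?thesis
    by (simp add: mult_op_L2_class)
qed

lemma mult_op_one: "mult_op (\<lambda>z. 1) x = x"
  by (cases x rule: L2_cases) (simp add: mult_op_L2_class L_infinity_const)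

lemma cinner_mult_op:
  assumes "\<phi> \<in> L_infinity"
  shows "cinner_L2 (mult_op \<phi> x) y = cinner_L2 x (mult_op (\<lambda>z. cnj (\<phi> z)) y)"
proof -
  obtain f g where "square_integrable f" "x = L2_class f" "square_integrable g" "y = L2_class g"
    using L2_cases by metis
  then show ?thesis
    using assms L_infinity_cnj[OF assms]
    by (simp add: mult_op_L2_class cinner_L2_class square_integrable_mult) (simp add: mult_ac)
qed

lemma cinner_flip: "cinner_L2 (flip x) y = cinner_L2 x (flip y)"
proof -
  obtain f g where f: "square_integrable f" "x = L2_class f"
    and g: "square_integrable g" "y = L2_class g"
    using L2_cases by metis
  have [measurable]: "f \<in> borel_measurable circle" "g \<in> borel_measurable circle"
    using f g square_integrable_measurable by auto
  have [measurable]: "(\<lambda>z. f z * cnj (g (cnj z))) \<in> borel_measurable circle"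
    by (intro borel_measurable_times borel_measurable_cnj_comp) measurable
  have "(\<integral>z. f z * cnj (g (cnj z)) \<partial>circle) = (\<integral>z. f z * cnj (g (cnj z)) \<partial>distr circle circle cnj)"
    by (simp only: distr_circle_cnj)
  also have "\<dots> = (\<integral>z. f (cnj z) * cnj (g z) \<partial>circle)"
    by (subst integral_distr) auto
  finally show ?thesis
    using f g by (simp add: flip_L2_class cinner_L2_class square_integrable_flip)
qed

lemma flip_mult_op:
  assumes "\<phi> \<in> L_infinity"
  shows "flip (mult_op \<phi> x) = mult_op (\<lambda>z. \<phi> (cnj z)) (flip x)"
  using assms L_infinity_flip[OF assms]
  by (cases x rule: L2_cases)
    (simp add: mult_op_L2_class flip_L2_class square_integrable_mult square_integrable_flip)

lemma AE_circle_norm: "AE z in circle. z * cnj z = 1"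
  by (rule AE_I2) (simp add: complex_norm_square[symmetric])

lemma mult_op_cnj_z: "mult_op cnj (mult_op (\<lambda>z. z) x) = x"
proof -
  have "mult_op cnj (mult_op (\<lambda>z. z) x) = mult_op (\<lambda>z. 1) x"
    using AE_circle_norm
    by (simp add: mult_op_mult_op L_infinity_id L_infinity_cnj_id)
      (intro mult_op_cong_AE L_infinity_mult L_infinity_id L_infinity_cnj_id L_infinity_const,
        auto simp: mult.commute)
  then show ?thesis by (simp add: mult_op_one)
qed

lemma mult_op_z_cnj: "mult_op (\<lambda>z. z) (mult_op cnj x) = x"
  using mult_op_cnj_z[of x]
  by (simp add: mult_op_mult_op L_infinity_id L_infinity_cnj_id mult.commute)

section \<open>Trigonometric monomials and the Hardy space\<close>

definition monomial :: "int \<Rightarrow> L2" where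
  "monomial n = L2_class (\<lambda>z. z powi n)"

lemma square_integrable_powi: "square_integrable (\<lambda>z. z powi n)"
  by (intro square_integrable_L_infinity L_infinity_powi)

lemma fourier_coeff_eq_cinner: "fourier_coeff x n = cinner_L2 x (monomial n)"
proof -
  obtain f where "square_integrable f" "x = L2_class f" by (rule L2_cases)
  then show ?thesis
    by (simp only: monomial_def cinner_L2_class square_integrable_powi fourier_coeff.abs_eq L2_eq_refl)
qed

lemma mult_op_z_monomial: "mult_op (\<lambda>z. z) (monomial n) = monomial (n + 1)"
  unfolding monomial_def mult_op_L2_class[OF L_infinity_id square_integrable_powi]
proof (intro L2_class_eqI square_integrable_mult L_infinity_id square_integrable_powi AE_I2)
  fix z :: complex assume "z \<in> space circle"
  then have "z \<noteq> 0" by auto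
  then show "z * z powi n = z powi (n + 1)" by (simp add: power_int_add)
qed

lemma mult_op_cnj_monomial: "mult_op cnj (monomial n) = monomial (n - 1)"
  using mult_op_cnj_z[of "monomial (n - 1)"] by (simp add: mult_op_z_monomial)

lemma cnj_powi_circle: "cmod z = 1 \<Longrightarrow> cnj (z powi n) = z powi (- n)"
proof -
  assume "cmod z = 1"
  then have "cnj (z powi n) * z powi n = 1" "z \<noteq> 0"
    using complex_norm_square[of "z powi n"] by (auto simp: norm_power_int mult.commute)
  then show ?thesis
    by (simp add: power_int_minus field_simps)
qed

lemma integral_powi_circle:
  assumes "n \<noteq> 0"
  shows "(\<integral>z. z powi n \<partial>circle) = 0"
proof -
  define c where "c = \<i> * of_int n"
  have c: "c \<noteq> 0" using assms by (simp add: c_def)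
  have powi: "cis t powi n = exp (c * of_real t)" for t
    by (simp only: cis_power_int) (simp add: cis_conv_exp c_def mult_ac)
  have U: "uniform_measure lborel {-pi..pi} = density lborel (\<lambda>x. ennreal (indicator {-pi..pi} x / (2 * pi)))"
    unfolding uniform_measure_def
    by (intro density_cong AE_I2) (auto simp: divide_ennreal[symmetric] split: split_indicator)
  have "(\<integral>z. z powi n \<partial>circle) = (\<integral>t. cis t powi n \<partial>uniform_measure lborel {-pi..pi})"
    unfolding circle_def
  proof (rule integral_distr)
    show "(\<lambda>z. z powi n) \<in> borel_measurable (restrict_space borel (sphere (0::complex) 1))"
      using borel_measurable_powi_circle[of n] by (simp cong: measurable_cong_sets)
  qed simp
  also have "\<dots> = (\<integral>t. (indicator {-pi..pi} t / (2 * pi)) *\<^sub>R exp (c * of_real t) \<partial>lborel)"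
    unfolding U powi
    by (subst integral_density) (auto intro!: borel_measurable_continuous_onI continuous_intros)
  also have "\<dots> = (\<integral>t. (1 / (2 * pi)) *\<^sub>R (indicator {-pi..pi} t *\<^sub>R exp (c * of_real t)) \<partial>lborel)"
    by simp
  also have "\<dots> = (1 / (2 * pi)) *\<^sub>R (\<integral>t. indicator {-pi..pi} t *\<^sub>R exp (c * of_real t) \<partial>lborel)"
    by (rule integral_scaleR_right)
  also have "(\<integral>t. indicator {-pi..pi} t *\<^sub>R exp (c * of_real t) \<partial>lborel)
      = exp (c * of_real pi) / c - exp (c * of_real (- pi)) / c"
  proof (rule integral_FTC_atLeastAtMost)
    show "continuous_on {- pi..pi} (\<lambda>x. exp (c * complex_of_real x))"
      by (intro continuous_intros)
    fix t
    have "((\<lambda>w. exp (c * w) / c) has_field_derivative exp (c * of_real t)) (at (of_real t))"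
      using c by (auto intro!: derivative_eq_intros)
    then show "((\<lambda>t. exp (c * of_real t) / c) has_vector_derivative exp (c * of_real t)) (at t within {-pi..pi})"
      by (intro has_vector_derivative_real_field has_vector_derivative_at_within)
  qed simp
  also have "exp (c * of_real pi) = exp (c * of_real (- pi))"
    by (subst exp_eq) (auto simp: c_def intro!: exI[of _ n])
  finally show ?thesis by simp
qed

lemma cinner_monomial_0: "cinner_L2 (monomial m) (monomial 0) = (if m = 0 then 1 else 0)"
proof -
  have "cinner_L2 (monomial m) (monomial 0) = (\<integral>z. z powi m \<partial>circle)"
    unfolding monomial_def by (subst cinner_L2_class[OF square_integrable_powi square_integrable_powi]) simp
  then show ?thesis
    using integral_powi_circle[of m] emeasure_circle by (simp add: measure_def)
qed

lemma hardy_eq_orth_compl: "hardy = orth_compl (monomial ` {..<0})"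
  by (auto simp: hardy_def orth_compl_def fourier_coeff_eq_cinner)

lemma csubspace_hardy: "csubspace hardy" and closed_hardy: "closed hardy"
  by (simp_all add: hardy_eq_orth_compl csubspace_orth_compl closed_orth_compl)

lemma hardyD: "x \<in> hardy \<Longrightarrow> n < 0 \<Longrightarrow> cinner_L2 x (monomial n) = 0"
  by (simp add: hardy_def fourier_coeff_eq_cinner)

lemma proj_P_hardy: "proj_P x \<in> hardy"
  using orth_proj_closed[OF csubspace_hardy closed_hardy] by (simp add: proj_P_def)

lemma proj_Q_orth: "g \<in> hardy \<Longrightarrow> cinner_L2 (proj_Q x) g = 0"
  using orth_proj_closed[OF csubspace_hardy closed_hardy, of x]
  by (simp add: proj_Q_def proj_P_def orth_compl_def)

lemma cinner_mult_z_left: "cinner_L2 (mult_op (\<lambda>z. z) x) y = cinner_L2 x (mult_op cnj y)"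
  by (rule cinner_mult_op[OF L_infinity_id])

lemma cinner_mult_cnj_left: "cinner_L2 (mult_op cnj x) y = cinner_L2 x (mult_op (\<lambda>z. z) y)"
  using cinner_mult_op[OF L_infinity_cnj_id] by simp

lemma monomial_0_hardy: "monomial 0 \<in> hardy"
proof -
  have "cinner_L2 (monomial n) (monomial 0) = 0" if "n < 0" for n
    using that by (simp add: cinner_monomial_0)
  then show ?thesis
    by (auto simp: hardy_def fourier_coeff_eq_cinner cinner_eq_0_commute[of "monomial 0"])
qed

lemma shift_hardy: "x \<in> hardy \<Longrightarrow> mult_op (\<lambda>z. z) x \<in> hardy"
  by (simp add: hardy_def fourier_coeff_eq_cinner cinner_mult_z_left mult_op_cnj_monomial)

text \<open>Only the constant term of \<open>x\<close> is moved to a negative index, and it is subtracted again.\<close>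

lemma backward_shift_hardy:
  assumes "x \<in> hardy"
  shows "mult_op cnj x - cinner_L2 x (monomial 0) *\<^sub>C monomial (-1) \<in> hardy"
proof -
  have "cinner_L2 (mult_op cnj (x - cinner_L2 x (monomial 0) *\<^sub>C monomial 0)) (monomial n) = 0"
    if "n < 0" for n
    using that hardyD[OF assms, of "n + 1"] hardyD[OF monomial_0_hardy, of "n + 1"]
    by (cases "n = -1")
      (auto simp: cinner_mult_cnj_left mult_op_z_monomial cinner_simps cinner_monomial_0)
  then show ?thesis
    by (simp add: hardy_def fourier_coeff_eq_cinner mult_op_diff mult_op_scaleC mult_op_cnj_monomial)
qed

section \<open>Multiplication by an inner function preserves the Hardy space\<close>

lemma inner_function_L_infinity: "inner_function \<theta> \<Longrightarrow> \<theta> \<in> L_infinity"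
  by (auto simp: inner_function_def L_infinity_def intro!: exI[of _ 1] elim: eventually_mono)

lemma square_integrable_integrable:
  assumes "square_integrable f" shows "integrable circle f"
  using integrable_mult_cnj[OF assms square_integrable_powi[of 0]] by simp

text \<open>Inside the disk \<open>\<theta>\<close> is its Taylor series, which converges absolutely on the circle of radius \<open>r\<close>
  and may be integrated term by term. The term of degree \<open>j\<close> contributes a multiple of the Fourier
  coefficient of \<open>f\<close> at \<open>n - j\<close>, and this index is negative.\<close>

lemma fourier_coeff_dilation_mult:
  assumes \<theta>: "\<theta> holomorphic_on ball 0 1" and r: "0 \<le> r" "r < 1"
    and f: "square_integrable f" "L2_class f \<in> hardy" and n: "n < 0"
  shows "(\<integral>z. \<theta> (of_real r * z) * f z * cnj (z powi n) \<partial>circle) = 0"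
proof -
  define a where "a j = (deriv ^^ j) \<theta> 0 / fact j" for j
  have sums: "(\<lambda>j. a j * w ^ j) sums \<theta> w" if "cmod w < 1" for w
    using holomorphic_power_series[OF \<theta>, of w] that by (simp add: a_def)
  \<comment> \<open>Any point between \<open>r\<close> and \<open>1\<close>: convergence there gives absolute convergence at \<open>r\<close>.\<close>
  define R where "R = (1 + r) / 2"
  have R: "r < R" "R < 1" using r by (simp_all add: R_def)
  have abs: "summable (\<lambda>j. cmod (a j * of_real r ^ j))"
    by (rule powser_insidea[of a "of_real R"]) (use R r sums_summable[OF sums[of "of_real R"]] in auto)
  define F where "F j z = a j * (of_real r * z) ^ j * f z * cnj (z powi n)" for j z
  have F_alt: "F j z = (a j * of_real r ^ j) * (f z * cnj (z powi (n - int j)))"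
    if "z \<in> space circle" for j z
  proof -
    have "z \<noteq> 0" "cmod z = 1" using that by auto
    then have "z ^ j * cnj (z powi n) = cnj (z powi (n - int j))"
      by (simp add: cnj_powi_circle power_int_add[symmetric] power_int_of_nat[symmetric]
          del: complex_cnj_power_int power_int_of_nat)
    then show ?thesis by (simp add: F_def power_mult_distrib mult_ac)
  qed
  have F_int: "integrable circle (F j)" and F_zero: "(\<integral>z. F j z \<partial>circle) = 0" for j
  proof -
    have i: "integrable circle (\<lambda>z. f z * cnj (z powi (n - int j)))"
      by (intro integrable_mult_cnj f square_integrable_powi)
    show "integrable circle (F j)"
      by (subst Bochner_Integration.integrable_cong[OF refl F_alt]) (use i in auto)
    have "(\<integral>z. F j z \<partial>circle) = (a j * of_real r ^ j) * (\<integral>z. f z * cnj (z powi (n - int j)) \<partial>circle)"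
      by (subst Bochner_Integration.integral_cong[OF refl F_alt]) auto
    also have "(\<integral>z. f z * cnj (z powi (n - int j)) \<partial>circle) = 0"
      using hardyD[OF f(2), of "n - int j"] n
      by (simp only: monomial_def cinner_L2_class f square_integrable_powi)
    finally show "(\<integral>z. F j z \<partial>circle) = 0" by simp
  qed
  have F_norm: "cmod (F j z) = cmod (a j * of_real r ^ j) * cmod (f z)" if "z \<in> space circle" for j z
    using that r by (simp add: F_def norm_mult norm_power norm_power_int)
  have "(\<lambda>j. \<integral>z. F j z \<partial>circle) sums (\<integral>z. (\<Sum>j. F j z) \<partial>circle)"
  proof (rule sums_integral[OF F_int])
    show "AE z in circle. summable (\<lambda>j. norm (F j z))"
      by (rule AE_I2, subst F_norm) (auto intro!: summable_mult2 abs)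
    have "(\<integral>z. cmod (F j z) \<partial>circle) = cmod (a j * of_real r ^ j) * (\<integral>z. cmod (f z) \<partial>circle)" for j
      by (subst Bochner_Integration.integral_cong[OF refl F_norm]) auto
    then show "summable (\<lambda>j. \<integral>z. cmod (F j z) \<partial>circle)"
      by (simp only:) (intro summable_mult2 abs)
  qed
  then have "(\<integral>z. (\<Sum>j. F j z) \<partial>circle) = 0"
    by (simp add: F_zero sums_iff)
  also have "(\<integral>z. (\<Sum>j. F j z) \<partial>circle) = (\<integral>z. \<theta> (of_real r * z) * f z * cnj (z powi n) \<partial>circle)"
  proof (rule Bochner_Integration.integral_cong[OF refl])
    fix z assume "z \<in> space circle"
    then have "cmod (of_real r * z) < 1" using r by (simp add: norm_mult)
    from sums_mult2[OF sums_mult2[OF sums[OF this], of "f z"], of "cnj (z powi n)"]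
    show "(\<Sum>j. F j z) = \<theta> (of_real r * z) * f z * cnj (z powi n)"
      by (simp add: F_def sums_iff)
  qed
  finally show ?thesis .
qed

text \<open>The products of \<open>x\<close> with dilations of \<open>\<theta>\<close> lie in the Hardy space. The dilations are uniformly
  bounded and converge to \<open>\<theta>\<close> almost everywhere along the radii, so the
  negative Fourier coefficients still vanish in the limit.\<close>

lemma inner_function_mult_hardy:
  assumes \<theta>: "inner_function \<theta>" and x: "x \<in> hardy"
  shows "mult_op \<theta> x \<in> hardy"
proof -
  obtain f where f: "square_integrable f" "x = L2_class f" by (rule L2_cases)
  have holo: "\<theta> holomorphic_on ball 0 1"
    and radial: "AE z in circle. ((\<lambda>r. \<theta> (of_real r * z)) \<longlongrightarrow> \<theta> z) (at_left 1)"
    and [measurable]: "\<theta> \<in> borel_measurable circle"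
    using \<theta> by (auto simp: inner_function_def)
  obtain B where B: "\<And>w. cmod w < 1 \<Longrightarrow> cmod (\<theta> w) \<le> B"
    using \<theta> unfolding inner_function_def bounded_iff by (metis image_eqI mem_ball_0)
  have [measurable]: "f \<in> borel_measurable circle"
    using f square_integrable_measurable by blast
  define r where "r k = 1 - 1 / real (Suc (Suc k))" for k
  have r: "0 \<le> r k" "r k < 1" for k by (simp_all add: r_def)
  have "r \<longlonglongrightarrow> 1 - 0"
    unfolding r_def using LIMSEQ_Suc[OF LIMSEQ_inverse_real_of_nat]
    by (intro tendsto_diff tendsto_const) (simp only: inverse_eq_divide)
  then have r_lim: "filterlim r (at_left 1) sequentially"
    using r by (intro tendsto_imp_filterlim_at_left) auto
  have "(\<integral>z. \<theta> z * f z * cnj (z powi n) \<partial>circle) = 0" if n: "n < 0" for n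
  proof -
    have powm [measurable]: "(\<lambda>z. cnj (z powi n)) \<in> borel_measurable circle"
      by (intro borel_measurable_cnj_comp borel_measurable_powi_circle)
    have "(\<lambda>k. \<integral>z. \<theta> (of_real (r k) * z) * f z * cnj (z powi n) \<partial>circle)
        \<longlonglongrightarrow> (\<integral>z. \<theta> z * f z * cnj (z powi n) \<partial>circle)"
    proof (rule integral_dominated_convergence)
      show "(\<lambda>z. \<theta> z * f z * cnj (z powi n)) \<in> borel_measurable circle"
        by (intro borel_measurable_times powm) measurable
      have cont: "continuous_on (sphere 0 1) (\<lambda>z. \<theta> (of_real (r k) * z))" for k
        by (rule continuous_on_compose2[OF holomorphic_on_imp_continuous_on[OF holo]])
          (use r[of k] in \<open>auto intro!: continuous_intros simp: norm_mult\<close>)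
      have [measurable]: "(\<lambda>z. \<theta> (of_real (r k) * z)) \<in> borel_measurable circle" for k
        using borel_measurable_continuous_on_restrict[OF cont] by (simp cong: measurable_cong_sets)
      show "(\<lambda>z. \<theta> (of_real (r k) * z) * f z * cnj (z powi n)) \<in> borel_measurable circle" for k
        by (intro borel_measurable_times powm) measurable
      show "integrable circle (\<lambda>z. B * cmod (f z))"
        using square_integrable_integrable[OF f(1)] by simp
      show "AE z in circle. (\<lambda>k. \<theta> (of_real (r k) * z) * f z * cnj (z powi n))
          \<longlonglongrightarrow> \<theta> z * f z * cnj (z powi n)"
        using radial
      proof eventually_elim
        case (elim z)
        show ?case
          by (intro tendsto_intros filterlim_compose[OF elim r_lim])
      qed
      show "AE z in circle. norm (\<theta> (of_real (r k) * z) * f z * cnj (z powi n)) \<le> B * cmod (f z)" for k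
        by (rule AE_I2) (use r[of k] B in \<open>auto simp: norm_mult norm_power_int intro!: mult_right_mono\<close>)
    qed
    then show ?thesis
      using fourier_coeff_dilation_mult[OF holo r f(1) _ n] x f(2)
      by (simp add: LIMSEQ_const_iff)
  qed
  then have "cinner_L2 (mult_op \<theta> x) (monomial n) = 0" if "n < 0" for n
    using that inner_function_L_infinity[OF \<theta>] f
    by (simp only: monomial_def mult_op_L2_class cinner_L2_class square_integrable_powi square_integrable_mult)
  then show ?thesis
    by (simp add: hardy_def fourier_coeff_eq_cinner)
qed

lemma inner_function_isometry:
  assumes "inner_function \<theta>"
  shows "mult_op (\<lambda>z. cnj (\<theta> z)) (mult_op \<theta> x) = x"
proof -
  have L: "\<theta> \<in> L_infinity" using assms by (rule inner_function_L_infinity)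
  have "AE z in circle. cmod (\<theta> z) = 1" using assms by (simp add: inner_function_def)
  then have "AE z in circle. cnj (\<theta> z) * \<theta> z = 1"
    by eventually_elim (metis complex_norm_square mult.commute of_real_1 one_power2)
  then have "mult_op (\<lambda>z. cnj (\<theta> z) * \<theta> z) x = mult_op (\<lambda>z. 1) x"
    by (intro mult_op_cong_AE L_infinity_mult L_infinity_cnj L L_infinity_const)
  then show ?thesis
    using L by (simp add: mult_op_mult_op L_infinity_cnj mult_op_one)
qed

text \<open>Evaluation at the origin is multiplicative. Splitting \<open>x = x(0) + z y\<close> with \<open>y\<close> in the Hardy space
  derives this from the invariance of the Hardy space alone: \<open>\<theta> z y = z (\<theta> y)\<close> has no constant term.\<close>

lemma zeroth_coeff_inner_mult:
  assumes \<theta>: "inner_function \<theta>" and x: "x \<in> hardy"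
  shows "cinner_L2 (mult_op \<theta> x) (monomial 0)
    = cinner_L2 x (monomial 0) * cinner_L2 (mult_op \<theta> (monomial 0)) (monomial 0)"
proof -
  define y where "y = mult_op cnj x - cinner_L2 x (monomial 0) *\<^sub>C monomial (-1)"
  have y: "y \<in> hardy" unfolding y_def by (rule backward_shift_hardy[OF x])
  have x_eq: "x = cinner_L2 x (monomial 0) *\<^sub>C monomial 0 + mult_op (\<lambda>z. z) y"
    by (simp add: y_def mult_op_diff mult_op_scaleC mult_op_z_cnj mult_op_z_monomial)
  have "mult_op \<theta> (mult_op (\<lambda>z. z) y) = mult_op (\<lambda>z. z) (mult_op \<theta> y)"
    by (simp add: mult_op_mult_op inner_function_L_infinity[OF \<theta>] L_infinity_id mult.commute)
  then have "cinner_L2 (mult_op \<theta> (mult_op (\<lambda>z. z) y)) (monomial 0) = 0"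
    using hardyD[OF inner_function_mult_hardy[OF \<theta> y], of "-1"]
    by (simp add: cinner_mult_z_left mult_op_cnj_monomial)
  then show ?thesis
    by (subst x_eq) (simp add: mult_op_add mult_op_scaleC cinner_simps)
qed

section \<open>The model space and its orthogonal projection\<close>

lemma csubspace_model_space: "csubspace (model_space \<theta>)"
  using csubspace_hardy csubspace_orth_compl[of "mult_op \<theta> ` hardy"]
  by (auto simp: model_space_def csubspace_def)

lemma csubspace_model_compl: "csubspace (model_compl \<theta>)"
  by (simp add: model_compl_def csubspace_orth_compl)

lemma cinner_model_compl_space:
  "m \<in> model_compl \<theta> \<Longrightarrow> k \<in> model_space \<theta> \<Longrightarrow> cinner_L2 m k = 0"
  by (simp add: model_compl_def orth_compl_def)

lemma cinner_model_space_compl: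
  "k \<in> model_space \<theta> \<Longrightarrow> m \<in> model_compl \<theta> \<Longrightarrow> cinner_L2 k m = 0"
  using cinner_model_compl_space cinner_eq_0_commute by blast

lemma model_spaceI:
  assumes "x \<in> hardy" "\<And>g. g \<in> hardy \<Longrightarrow> cinner_L2 x (mult_op \<theta> g) = 0"
  shows "x \<in> model_space \<theta>"
  using assms by (auto simp: model_space_def orth_compl_def)

lemma model_space_hardy: "k \<in> model_space \<theta> \<Longrightarrow> k \<in> hardy"
  by (simp add: model_space_def)

lemma model_space_orth: "k \<in> model_space \<theta> \<Longrightarrow> g \<in> hardy \<Longrightarrow> cinner_L2 k (mult_op \<theta> g) = 0"
  by (simp add: model_space_def orth_compl_def)

lemma proj_Q\<theta>_model_compl: "proj_Q\<theta> \<theta> x \<in> model_compl \<theta>"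
proof -
  have "cinner_L2 (proj_Q\<theta> \<theta> x) k = 0" if k: "k \<in> model_space \<theta>" for k
    using proj_Q_orth[OF model_space_hardy[OF k]] model_space_orth[OF k proj_P_hardy]
    by (simp add: proj_Q\<theta>_def cinner_add_left cinner_eq_0_commute[of "mult_op \<theta> _" k])
  then show ?thesis by (simp add: model_compl_def orth_compl_def)
qed

text \<open>The difference is \<open>P x - \<theta> P (cnj \<theta> x)\<close>. Both summands lie in the Hardy space, and since
  multiplication by \<open>\<theta>\<close> is isometric, both have the same inner products with \<open>\<theta> g\<close> as \<open>x\<close>.\<close>

lemma diff_proj_Q\<theta>_model_space:
  assumes \<theta>: "inner_function \<theta>"
  shows "x - proj_Q\<theta> \<theta> x \<in> model_space \<theta>"
proof (rule model_spaceI)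
  let ?p = "proj_P (mult_op (\<lambda>z. cnj (\<theta> z)) x)"
  have "x - proj_Q\<theta> \<theta> x = proj_P x - mult_op \<theta> ?p"
    by (simp add: proj_Q\<theta>_def proj_Q_def)
  then show "x - proj_Q\<theta> \<theta> x \<in> hardy"
    by (simp add: csubspace_diff[OF csubspace_hardy] proj_P_hardy inner_function_mult_hardy[OF \<theta>])
  fix g assume g: "g \<in> hardy"
  have L: "\<theta> \<in> L_infinity" using \<theta> by (rule inner_function_L_infinity)
  have "cinner_L2 (mult_op \<theta> ?p) (mult_op \<theta> g) = cinner_L2 ?p g"
    using cinner_mult_op[OF L] by (simp add: inner_function_isometry[OF \<theta>])
  also have "\<dots> = cinner_L2 (mult_op (\<lambda>z. cnj (\<theta> z)) x) g"
    using proj_Q_orth[OF g, of "mult_op (\<lambda>z. cnj (\<theta> z)) x"] by (simp add: proj_Q_def cinner_simps)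
  also have "\<dots> = cinner_L2 x (mult_op \<theta> g)"
    using cinner_mult_op[OF L_infinity_cnj[OF L]] by simp
  finally show "cinner_L2 (x - proj_Q\<theta> \<theta> x) (mult_op \<theta> g) = 0"
    using proj_Q_orth[OF inner_function_mult_hardy[OF \<theta> g], of x]
    by (simp add: proj_Q\<theta>_def cinner_simps)
qed

text \<open>The two subspaces are orthogonal, so a splitting of \<open>x\<close> between them is unique. This is how values
  of the projection are computed below: by exhibiting the splitting.\<close>

lemma proj_Q\<theta>_eqI:
  assumes \<theta>: "inner_function \<theta>" and m: "m \<in> model_compl \<theta>" and k: "x - m \<in> model_space \<theta>"
  shows "proj_Q\<theta> \<theta> x = m"
proof -
  have "proj_Q\<theta> \<theta> x - m \<in> model_compl \<theta>"
    by (intro csubspace_diff csubspace_model_compl m proj_Q\<theta>_model_compl)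
  moreover have "(x - m) - (x - proj_Q\<theta> \<theta> x) \<in> model_space \<theta>"
    by (intro csubspace_diff csubspace_model_space k diff_proj_Q\<theta>_model_space \<theta>)
  ultimately have "cinner_L2 (proj_Q\<theta> \<theta> x - m) (proj_Q\<theta> \<theta> x - m) = 0"
    using cinner_model_compl_space by fastforce
  then show ?thesis using cinner_self_eq_0 by fastforce
qed

lemma proj_Q\<theta>_diff:
  assumes "inner_function \<theta>"
  shows "proj_Q\<theta> \<theta> (x - y) = proj_Q\<theta> \<theta> x - proj_Q\<theta> \<theta> y"
proof (rule proj_Q\<theta>_eqI[OF assms])
  show "proj_Q\<theta> \<theta> x - proj_Q\<theta> \<theta> y \<in> model_compl \<theta>"
    by (intro csubspace_diff csubspace_model_compl proj_Q\<theta>_model_compl)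
  have "(x - proj_Q\<theta> \<theta> x) - (y - proj_Q\<theta> \<theta> y) \<in> model_space \<theta>"
    by (intro csubspace_diff csubspace_model_space diff_proj_Q\<theta>_model_space assms)
  then show "x - y - (proj_Q\<theta> \<theta> x - proj_Q\<theta> \<theta> y) \<in> model_space \<theta>"
    by (simp add: algebra_simps)
qed

lemma proj_Q\<theta>_scaleC:
  assumes "inner_function \<theta>"
  shows "proj_Q\<theta> \<theta> (c *\<^sub>C x) = c *\<^sub>C proj_Q\<theta> \<theta> x"
proof (rule proj_Q\<theta>_eqI[OF assms])
  show "c *\<^sub>C proj_Q\<theta> \<theta> x \<in> model_compl \<theta>"
    using csubspace_model_compl proj_Q\<theta>_model_compl by (simp add: csubspace_def)
  have "c *\<^sub>C (x - proj_Q\<theta> \<theta> x) \<in> model_space \<theta>"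
    using csubspace_model_space diff_proj_Q\<theta>_model_space[OF assms] by (simp add: csubspace_def)
  moreover have "c *\<^sub>C (x - proj_Q\<theta> \<theta> x) = c *\<^sub>C x - c *\<^sub>C proj_Q\<theta> \<theta> x"
    using scaleC_add_right[of c "x - proj_Q\<theta> \<theta> x" "proj_Q\<theta> \<theta> x"] by simp
  ultimately show "c *\<^sub>C x - c *\<^sub>C proj_Q\<theta> \<theta> x \<in> model_space \<theta>" by simp
qed

lemma cinner_proj_Q\<theta>_left:
  assumes "inner_function \<theta>" "m \<in> model_compl \<theta>"
  shows "cinner_L2 (proj_Q\<theta> \<theta> x) m = cinner_L2 x m"
  using cinner_model_space_compl[OF diff_proj_Q\<theta>_model_space[OF assms(1)] assms(2), of x]
  by (simp add: cinner_simps)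

lemma cinner_proj_Q\<theta>_right:
  assumes "inner_function \<theta>" "m \<in> model_compl \<theta>"
  shows "cinner_L2 m (proj_Q\<theta> \<theta> x) = cinner_L2 m x"
  using cinner_proj_Q\<theta>_left[OF assms] by (metis cinner_commute)

section \<open>The kernel at the origin\<close>

text \<open>The reproducing kernel of the model space at the origin, \<open>1 - cnj \<theta>(0) * \<theta>\<close>. It is the projection
  of the constant function \<open>1\<close> to the model space.\<close>

definition kernel0 :: "(complex \<Rightarrow> complex) \<Rightarrow> L2" where
  "kernel0 \<theta> = monomial 0 -
     cnj (cinner_L2 (mult_op \<theta> (monomial 0)) (monomial 0)) *\<^sub>C mult_op \<theta> (monomial 0)"

lemma kernel0_model_space:
  assumes \<theta>: "inner_function \<theta>"
  shows "kernel0 \<theta> \<in> model_space \<theta>"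
proof (rule model_spaceI)
  have "c *\<^sub>C mult_op \<theta> (monomial 0) \<in> hardy" for c
    using csubspace_hardy inner_function_mult_hardy[OF \<theta> monomial_0_hardy] by (simp add: csubspace_def)
  then show "kernel0 \<theta> \<in> hardy"
    unfolding kernel0_def by (intro csubspace_diff csubspace_hardy monomial_0_hardy)
  fix g assume g: "g \<in> hardy"
  have "cinner_L2 (mult_op \<theta> (monomial 0)) (mult_op \<theta> g) = cinner_L2 (monomial 0) g"
    using cinner_mult_op[OF inner_function_L_infinity[OF \<theta>]]
    by (simp add: inner_function_isometry[OF \<theta>])
  moreover have "cinner_L2 (monomial 0) (mult_op \<theta> g)
      = cinner_L2 (monomial 0) g * cnj (cinner_L2 (mult_op \<theta> (monomial 0)) (monomial 0))"
    using zeroth_coeff_inner_mult[OF \<theta> g] by (metis cinner_commute complex_cnj_mult)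
  ultimately show "cinner_L2 (kernel0 \<theta>) (mult_op \<theta> g) = 0"
    by (simp add: kernel0_def cinner_simps)
qed

lemma cinner_kernel0:
  assumes "k \<in> model_space \<theta>"
  shows "cinner_L2 k (kernel0 \<theta>) = cinner_L2 k (monomial 0)"
  using model_space_orth[OF assms monomial_0_hardy] by (simp add: kernel0_def cinner_simps)

lemma zbar_model_compl: "monomial (-1) \<in> model_compl \<theta>"
  using hardyD[OF model_space_hardy, of _ \<theta> "-1"] cinner_eq_0_commute
  by (auto simp: model_compl_def orth_compl_def)

text \<open>The model space is invariant under the backward shift \<open>k \<mapsto> (k - k(0)) / z\<close>: orthogonality to
  \<open>\<theta> g\<close> is inherited from orthogonality of \<open>k\<close> to \<open>\<theta> z g\<close>.\<close>

lemma backward_shift_model_space: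
  assumes \<theta>: "inner_function \<theta>" and k: "k \<in> model_space \<theta>"
  shows "mult_op cnj k - cinner_L2 k (monomial 0) *\<^sub>C monomial (-1) \<in> model_space \<theta>"
proof (rule model_spaceI)
  show "mult_op cnj k - cinner_L2 k (monomial 0) *\<^sub>C monomial (-1) \<in> hardy"
    by (rule backward_shift_hardy[OF model_space_hardy[OF k]])
  fix g assume g: "g \<in> hardy"
  have "mult_op (\<lambda>z. z) (mult_op \<theta> g) = mult_op \<theta> (mult_op (\<lambda>z. z) g)"
    by (simp add: mult_op_mult_op inner_function_L_infinity[OF \<theta>] L_infinity_id mult.commute)
  then have "cinner_L2 (mult_op cnj k) (mult_op \<theta> g) = 0"
    by (simp add: cinner_mult_cnj_left model_space_orth[OF k shift_hardy[OF g]])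
  moreover have "cinner_L2 (monomial (-1)) (mult_op \<theta> g) = 0"
    using hardyD[OF inner_function_mult_hardy[OF \<theta> g], of "-1"] cinner_eq_0_commute by simp
  ultimately show "cinner_L2 (mult_op cnj k - cinner_L2 k (monomial 0) *\<^sub>C monomial (-1)) (mult_op \<theta> g) = 0"
    by (simp add: cinner_simps)
qed

text \<open>For \<open>k\<close> in the model space, \<open>z h\<close> has the same inner product with \<open>k\<close> as \<open>h\<close> has with
  \<open>cnj z * k\<close>, and of the latter only the part \<open>k(0) * cnj z\<close> is not orthogonal to \<open>h\<close>. So in the model
  space \<open>z h\<close> is represented by a multiple of the reproducing kernel at the origin.\<close>

lemma compressed_shift_eq:
  assumes \<theta>: "inner_function \<theta>" and h: "h \<in> model_compl \<theta>"
  shows "compressed_shift \<theta> h = mult_op (\<lambda>z. z) h - cinner_L2 h (monomial (-1)) *\<^sub>C kernel0 \<theta>"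
  unfolding compressed_shift_def
proof (rule proj_Q\<theta>_eqI[OF \<theta>])
  let ?c = "cinner_L2 h (monomial (-1))"
  have "?c *\<^sub>C kernel0 \<theta> \<in> model_space \<theta>"
    using csubspace_model_space kernel0_model_space[OF \<theta>] by (simp add: csubspace_def)
  then show "mult_op (\<lambda>z. z) h - (mult_op (\<lambda>z. z) h - ?c *\<^sub>C kernel0 \<theta>) \<in> model_space \<theta>"
    by simp
  have "cinner_L2 (mult_op (\<lambda>z. z) h - ?c *\<^sub>C kernel0 \<theta>) k = 0" if k: "k \<in> model_space \<theta>" for k
  proof -
    have "cinner_L2 h (mult_op cnj k) = ?c * cnj (cinner_L2 k (monomial 0))"
      using cinner_model_compl_space[OF h backward_shift_model_space[OF \<theta> k]]
      by (simp add: cinner_simps mult.commute)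
    moreover have "cinner_L2 (kernel0 \<theta>) k = cnj (cinner_L2 k (monomial 0))"
      using cinner_kernel0[OF k] cinner_commute by metis
    ultimately show ?thesis by (simp add: cinner_simps cinner_mult_z_left)
  qed
  then show "mult_op (\<lambda>z. z) h - ?c *\<^sub>C kernel0 \<theta> \<in> model_compl \<theta>"
    by (simp add: model_compl_def orth_compl_def)
qed

text \<open>The backward shift keeps the component \<open>k\<close> of \<open>x\<close> in the model space there, so only \<open>k(0)\<close> times
  \<open>cnj\<close> survives the projection. The kernel cannot tell \<open>x\<close> from \<open>k\<close>, since it is in the model space.\<close>

lemma proj_Q\<theta>_zbar_defect:
  assumes \<theta>: "inner_function \<theta>"
  shows "proj_Q\<theta> \<theta> (mult_op cnj (x - proj_Q\<theta> \<theta> x)) = cinner_L2 x (kernel0 \<theta>) *\<^sub>C monomial (-1)"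
proof (rule proj_Q\<theta>_eqI[OF \<theta>])
  let ?k = "x - proj_Q\<theta> \<theta> x"
  have k: "?k \<in> model_space \<theta>" by (rule diff_proj_Q\<theta>_model_space[OF \<theta>])
  show "cinner_L2 x (kernel0 \<theta>) *\<^sub>C monomial (-1) \<in> model_compl \<theta>"
    using csubspace_model_compl zbar_model_compl by (simp add: csubspace_def)
  have "cinner_L2 x (kernel0 \<theta>) = cinner_L2 ?k (monomial 0)"
    using cinner_kernel0[OF k] cinner_model_compl_space[OF proj_Q\<theta>_model_compl kernel0_model_space[OF \<theta>], of x]
    by (simp add: cinner_simps)
  then show "mult_op cnj ?k - cinner_L2 x (kernel0 \<theta>) *\<^sub>C monomial (-1) \<in> model_space \<theta>"
    using backward_shift_model_space[OF \<theta> k] by simp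
qed

text \<open>On elements of \<open>model_compl \<theta>\<close> the projection can be dropped from either side of an inner product,
  and multiplication by \<open>cnj\<close> is the adjoint of multiplication by \<open>z\<close>.\<close>

lemma adjoint_compressed_shift:
  assumes \<theta>: "inner_function \<theta>" and g: "g \<in> model_compl \<theta>"
  shows "adjoint_on (model_compl \<theta>) (compressed_shift \<theta>) g = proj_Q\<theta> \<theta> (mult_op cnj g)"
  unfolding adjoint_on_def
proof (rule the_equality)
  have adj: "cinner_L2 (compressed_shift \<theta> h) g = cinner_L2 h (proj_Q\<theta> \<theta> (mult_op cnj g))"
    if "h \<in> model_compl \<theta>" for h
    using that g \<theta>
    by (simp add: compressed_shift_def cinner_proj_Q\<theta>_left cinner_proj_Q\<theta>_right cinner_mult_z_left)
  then show "proj_Q\<theta> \<theta> (mult_op cnj g) \<in> model_compl \<theta> \<and>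
      (\<forall>h\<in>model_compl \<theta>. cinner_L2 (compressed_shift \<theta> h) g = cinner_L2 h (proj_Q\<theta> \<theta> (mult_op cnj g)))"
    by (simp add: proj_Q\<theta>_model_compl)
  fix k assume k: "k \<in> model_compl \<theta> \<and>
    (\<forall>h\<in>model_compl \<theta>. cinner_L2 (compressed_shift \<theta> h) g = cinner_L2 h k)"
  let ?d = "k - proj_Q\<theta> \<theta> (mult_op cnj g)"
  have "?d \<in> model_compl \<theta>"
    using k by (intro csubspace_diff csubspace_model_compl proj_Q\<theta>_model_compl) simp
  then have "cinner_L2 ?d ?d = 0"
    using k adj by (simp add: cinner_diff_right)
  then show "k = proj_Q\<theta> \<theta> (mult_op cnj g)"
    using cinner_self_eq_0 by fastforce
qed

section \<open>The commutator identity\<close>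

lemma star_L_infinity: "\<phi> \<in> L_infinity \<Longrightarrow> star \<phi> \<in> L_infinity"
  using L_infinity_cnj[OF L_infinity_flip] by (simp add: star_def[abs_def])

text \<open>Membership of \<open>\<phi>\<close> in \<open>L_infinity\<close> lets the product with the bounded function
  \<open>1 - cnj \<theta>(0) * \<theta>\<close> be read as a multiplication operator applied to a vector.\<close>

lemma alpha_eq:
  assumes \<theta>: "inner_function \<theta>" and \<phi>: "\<phi> \<in> L_infinity"
  shows "alpha \<theta> \<phi> = mult_op \<phi> (kernel0 \<theta>)"
proof -
  have L: "\<theta> \<in> L_infinity" using \<theta> by (rule inner_function_L_infinity)
  have one: "square_integrable (\<lambda>z. 1)"
    using square_integrable_powi[of 0] by simp
  have s: "square_integrable \<theta>" using L by (rule square_integrable_L_infinity)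
  have m0: "monomial 0 = L2_class (\<lambda>z. 1)"
    by (simp add: monomial_def)
  have \<theta>m0: "mult_op \<theta> (monomial 0) = L2_class \<theta>"
    using L one by (simp add: m0 mult_op_L2_class)
  define c where "c = cnj (fourier_coeff (L2_class \<theta>) 0)"
  have "kernel0 \<theta> = monomial 0 - c *\<^sub>C L2_class \<theta>"
    by (simp only: kernel0_def \<theta>m0 c_def fourier_coeff_eq_cinner)
  also have "\<dots> = L2_class (\<lambda>z. 1 - c * \<theta> z)"
    using s one by (simp add: m0 L2_class_scaleC L2_class_diff square_integrable_cmult)
  finally have "kernel0 \<theta> = L2_class (\<lambda>z. 1 - c * \<theta> z)" .
  then show ?thesis
    using \<phi> s one
    by (simp add: alpha_def c_def mult_op_L2_class square_integrable_diff square_integrable_cmult)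
qed

theorem theorem2p2:
  fixes \<theta> \<phi> :: "complex \<Rightarrow> complex"
  assumes "inner_function \<theta>" and "\<phi> \<in> L_infinity"
  shows "\<forall>h \<in> model_compl \<theta>.
    dual_trunc_hankel \<theta> \<phi> (compressed_shift \<theta> h)
      - adjoint_on (model_compl \<theta>) (compressed_shift \<theta>) (dual_trunc_hankel \<theta> \<phi> h)
    = (L2_class cnj \<otimes> proj_Q\<theta> \<theta> (flip (alpha \<theta> (star \<phi>)))) h
      - (proj_Q\<theta> \<theta> (flip (alpha \<theta> \<phi>)) \<otimes> L2_class cnj) h"
proof
  note \<theta> = assms(1) and \<phi> = assms(2)
  fix h assume h: "h \<in> model_compl \<theta>"
  have zbar: "L2_class cnj = monomial (-1)"
    unfolding monomial_def
  proof (intro L2_class_eqI square_integrable_powi square_integrable_L_infinity L_infinity_cnj_id AE_I2)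
    fix z :: complex assume "z \<in> space circle"
    then show "cnj z = z powi -1" using cnj_powi_circle[of z 1] by simp
  qed
  define g where "g = flip (mult_op \<phi> h)"
  define c where "c = cinner_L2 h (monomial (-1))"
  \<comment> \<open>The flip intertwines multiplication by \<open>z\<close> and by its conjugate, whence the cancellation.\<close>
  have "flip (mult_op \<phi> (mult_op (\<lambda>z. z) h)) = flip (mult_op (\<lambda>z. z) (mult_op \<phi> h))"
    using \<phi> by (simp add: mult_op_mult_op L_infinity_id mult.commute)
  also have "\<dots> = mult_op cnj g"
    by (simp add: flip_mult_op[OF L_infinity_id] g_def)
  finally have swap: "flip (mult_op \<phi> (mult_op (\<lambda>z. z) h)) = mult_op cnj g" .
  have HU: "dual_trunc_hankel \<theta> \<phi> (compressed_shift \<theta> h)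
      = proj_Q\<theta> \<theta> (mult_op cnj g) - c *\<^sub>C proj_Q\<theta> \<theta> (flip (alpha \<theta> \<phi>))"
    by (simp add: dual_trunc_hankel_def compressed_shift_eq[OF \<theta> h] c_def alpha_eq[OF \<theta> \<phi>]
        mult_op_diff mult_op_scaleC flip_diff flip_scaleC swap proj_Q\<theta>_diff[OF \<theta>] proj_Q\<theta>_scaleC[OF \<theta>])
  have UH: "adjoint_on (model_compl \<theta>) (compressed_shift \<theta>) (dual_trunc_hankel \<theta> \<phi> h)
      = proj_Q\<theta> \<theta> (mult_op cnj (proj_Q\<theta> \<theta> g))"
    by (simp add: dual_trunc_hankel_def g_def adjoint_compressed_shift[OF \<theta> proj_Q\<theta>_model_compl])
  have defect: "proj_Q\<theta> \<theta> (mult_op cnj g) - proj_Q\<theta> \<theta> (mult_op cnj (proj_Q\<theta> \<theta> g))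
      = cinner_L2 g (kernel0 \<theta>) *\<^sub>C monomial (-1)"
    using proj_Q\<theta>_zbar_defect[OF \<theta>, of g] by (simp add: mult_op_diff proj_Q\<theta>_diff[OF \<theta>])
  have "cinner_L2 g (kernel0 \<theta>) = cinner_L2 h (mult_op (\<lambda>z. cnj (\<phi> z)) (flip (kernel0 \<theta>)))"
    by (simp add: g_def cinner_flip cinner_mult_op[OF \<phi>])
  also have "mult_op (\<lambda>z. cnj (\<phi> z)) (flip (kernel0 \<theta>)) = flip (alpha \<theta> (star \<phi>))"
    by (simp add: alpha_eq[OF \<theta> star_L_infinity[OF \<phi>]] flip_mult_op[OF star_L_infinity[OF \<phi>]] star_def)
  also have "cinner_L2 h \<dots> = cinner_L2 h (proj_Q\<theta> \<theta> (flip (alpha \<theta> (star \<phi>))))"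
    by (simp add: cinner_proj_Q\<theta>_right[OF \<theta> h])
  finally have coeff: "cinner_L2 g (kernel0 \<theta>) = cinner_L2 h (proj_Q\<theta> \<theta> (flip (alpha \<theta> (star \<phi>))))" .
  show "dual_trunc_hankel \<theta> \<phi> (compressed_shift \<theta> h)
      - adjoint_on (model_compl \<theta>) (compressed_shift \<theta>) (dual_trunc_hankel \<theta> \<phi> h)
    = (L2_class cnj \<otimes> proj_Q\<theta> \<theta> (flip (alpha \<theta> (star \<phi>)))) h
      - (proj_Q\<theta> \<theta> (flip (alpha \<theta> \<phi>)) \<otimes> L2_class cnj) h"
    using HU UH defect coeff by (simp add: rank_one_def zbar c_def algebra_simps)
qed

end
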